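(* Let $U\subset\mathbb{R}^2$ be a sufficiently small domain divided by a straight line $\Gamma_0:=\{y=0\}$ (restricted to $U$) into two components $U_1\subset\mathbb{R}^2_+$ and $U_2\subset\mathbb{R}^2_-$, and let $(x_0,y_0)\in U_1$ and $(x_0,-y_0)\in U_2$. Then any biharmonic function $u(x,y)$ in the domain $U_1$ subject to one of the conditions (i)--(v) below on $\Gamma_0$ can be continued to the domain $U_2$, using the following formulas: (i) if $u=\partial_n u=0$ on $\Gamma_0$, then $$u(x_0,y_0)=-u(x_0,-y_0)-2y_0\,\frac{\partial u}{\partial y}(x_0,-y_0)-y_0^2\,\Delta u(x_0,-y_0);$$ (ii) if $u=\Delta u=0$ on $\Gamma_0$, then $$u(x_0,y_0)=-u(x_0,-y_0);$$ (iii) if $u=\partial_n\Delta u=0$ on $\Gamma_0$, then $$u(x_0,y_0)=-u(x_0,-y_0)-y_0\int_{0}^{-y_0}\Delta u(x_0,y)\,dy,$$ where the integral is computed along the segment parallel to the $y$-axis; (iv) if $\partial_n u=\Delta u=0$ on $\Gamma_0$, then $$u(x_0,y_0)=u(x_0,-y_0)-\int_{0}^{-y_0}y\,\Delta u(x_0,y)\,dy;$$ (v) if $\partial_n u=\partial_n\Delta u=0$ on $\Gamma_0$, then $$u(x_0,y_0)=u(x_0,-y_0).$$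
   Context: $\Delta=\partial^2/\partial x^2+\partial^2/\partial y^2$ is the Laplacian. A function $u(x,y)$ of class $C^4$ on a domain is called biharmonic there if $\Delta^2u=0$. $\mathbb{R}^2_+$ and $\mathbb{R}^2_-$ are the open upper and lower half planes $\{y>0\}$ and $\{y<0\}$. $\partial_n$ denotes the normal derivative on the boundary line $\Gamma_0$. In the formulas, $u$ on the two sides denotes the function together with its continuation across $\Gamma_0$; each formula relates the value at $(x_0,y_0)\in U_1$ to values at points on the other side of $\Gamma_0$ (and, where an integral occurs, along the segment from $(x_0,0)$ to $(x_0,-y_0)$). *)

theory Defs
  imports "HOL-Analysis.Analysis"
begin

definition dx :: "(real \<times> real \<Rightarrow> real) \<Rightarrow> real \<times> real \<Rightarrow> real" where
  "dx f p = deriv (\<lambda>t. f (t, snd p)) (fst p)"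

definition dy :: "(real \<times> real \<Rightarrow> real) \<Rightarrow> real \<times> real \<Rightarrow> real" where
  "dy f p = deriv (\<lambda>t. f (fst p, t)) (snd p)"

definition laplacian :: "(real \<times> real \<Rightarrow> real) \<Rightarrow> real \<times> real \<Rightarrow> real" where
  "laplacian f p = dx (dx f) p + dy (dy f) p"

text \<open>Class $C^k$ on an open set. Differentiability in the recursive clause guarantees that the
  partial derivatives taken by \<^const>\<open>deriv\<close> really exist.\<close>

fun Ck_on :: "nat \<Rightarrow> (real \<times> real) set \<Rightarrow> (real \<times> real \<Rightarrow> real) \<Rightarrow> bool" where
  "Ck_on 0 S f \<longleftrightarrow> continuous_on S f"
| "Ck_on (Suc k) S f \<longleftrightarrow> f differentiable_on S \<and> Ck_on k S (dx f) \<and> Ck_on k S (dy f)"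

definition biharmonic_on :: "(real \<times> real) set \<Rightarrow> (real \<times> real \<Rightarrow> real) \<Rightarrow> bool" where
  "biharmonic_on S u \<longleftrightarrow> Ck_on 4 S u \<and> (\<forall>p\<in>S. laplacian (laplacian u) p = 0)"

text \<open>\<open>f = 0\<close> on the boundary part \<open>G\<close> of the domain \<open>S\<close> on which \<open>f\<close> lives, in the sense of
  boundary values: \<open>f\<close> extends continuously by \<open>0\<close> to \<open>G\<close>. No other regularity of \<open>f\<close> up to \<open>G\<close>
  is asked for, and the values of \<open>f\<close> outside \<open>S\<close> play no role. The normal derivative on a
  horizontal line is \<open>dy\<close> up to sign, so the sign of the normal is irrelevant for its vanishing.\<close>

definition vanishes_on :: "(real \<times> real) set \<Rightarrow> (real \<times> real) set \<Rightarrow> (real \<times> real \<Rightarrow> real) \<Rightarrow> bool"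
  where "vanishes_on S G f \<longleftrightarrow> (\<forall>p\<in>G. (f \<longlongrightarrow> 0) (at p within S))"

text \<open>The domain \<open>U\<close> is small enough for the reflection in the line \<open>y = 0\<close>: mirror images of
  points of the lower part \<open>U2\<close> lie in the upper part \<open>U1\<close>, and the vertical segments joining
  points of \<open>U2\<close> to the line stay in \<open>U\<close>. Mere smallness of the diameter would not do, all
  notions involved being invariant under scaling.\<close>

definition reflection_small ::
  "(real \<times> real) set \<Rightarrow> (real \<times> real) set \<Rightarrow> (real \<times> real) set \<Rightarrow> bool" where
  "reflection_small U U1 U2 \<longleftrightarrow>
     (\<forall>x y. (x, y) \<in> U2 \<longrightarrow> (x, - y) \<in> U1 \<and> closed_segment (x, 0) (x, y) \<subseteq> U)"

text \<open>Every disc centred on the line is small in this sense.\<close>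

lemma reflection_small_ball:
  fixes a r :: real
  defines "U \<equiv> ball (a, 0) r"
  shows "reflection_small U (U \<inter> {p. snd p > 0}) (U \<inter> {p. snd p < 0})"
proof -
  have "(x, - y) \<in> U" "closed_segment (x, 0) (x, y) \<subseteq> U" if "(x, y) \<in> U" for x y
  proof -
    have xy: "sqrt ((a - x)\<^sup>2 + y\<^sup>2) < r"
      using that by (simp add: U_def dist_Pair_Pair dist_real_def)
    then show "(x, - y) \<in> U"
      by (simp add: U_def dist_Pair_Pair dist_real_def)
    have "\<bar>a - x\<bar> \<le> sqrt ((a - x)\<^sup>2 + y\<^sup>2)"
      by (rule real_sqrt_ge_abs1)
    with xy have "\<bar>a - x\<bar> < r"
      by linarith
    then have "(x, 0) \<in> U"
      by (simp add: U_def dist_Pair_Pair dist_real_def)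
    with that show "closed_segment (x, 0) (x, y) \<subseteq> U"
      by (simp add: U_def closed_segment_subset)
  qed
  then show ?thesis
    by (auto simp: reflection_small_def)
qed

definition biharmonic_continuation ::
  "(real \<times> real) set \<Rightarrow> (real \<times> real) set \<Rightarrow> (real \<times> real \<Rightarrow> real) \<Rightarrow> (real \<times> real \<Rightarrow> real) \<Rightarrow> bool"
  where "biharmonic_continuation S T u v \<longleftrightarrow> biharmonic_on T v \<and> (\<forall>p\<in>S. v p = u p)"

end

theory Submission imports Defs "HOL-Complex_Analysis.Complex_Analysis" begin

text \<open>A biharmonic function on a convex domain has Goursat's form \<open>u = Re A + y Re B\<close> with
  holomorphic \<open>A\<close> and \<open>B\<close>, and then \<open>\<Delta>u = 2 Re (\<i>B')\<close>, \<open>u\<^sub>y = Re (\<i>A' + B) + y Re (\<i>B')\<close> and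
  \<open>(\<Delta>u)\<^sub>y = - 2 Re B''\<close>. Every boundary condition therefore says that the real part of some
  holomorphic function built from \<open>A\<close> and \<open>B\<close> tends to zero at the line, possibly up to a term with
  a factor \<open>y\<close>. Such a function continues across the line by Schwarz reflection, hence so do \<open>A\<close> and
  \<open>B\<close>, and \<open>Re A + y Re B\<close> is the continuation of \<open>u\<close>. The symmetry that reflection imposes on
  the continued functions is what the five formulas express.

  The conditions are limits only; no regularity of \<open>u\<close> up to the line is given, and two facts
  have to make up for it.

  The first is Schwarz reflection for a holomorphic \<open>F\<close> of which one knows only that
  \<open>Re F\<close> tends to zero (\<open>strong_Schwarz_reflection\<close>). Boundedness of \<open>Re F\<close> gives
  \<open>F' = O(1/y)\<close>, so \<open>F\<close> grows at most logarithmically and a primitive of \<open>F\<close> is continuous up to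
  the line. There the real part of the primitive is constant, the classical reflection principle
  applies to the primitive, and differentiation gives the continuation of \<open>F\<close>.

  The second concerns the conditions \<open>u = u\<^sub>y = 0\<close>, neither of which isolates a holomorphic function
  at once (\<open>clamped_boundary\<close>). They imply \<open>u = o(y)\<close>; Pizzetti's mean value formula turns
  this into \<open>y \<Delta>u \<rightarrow> 0\<close>, so that \<open>W = \<i>A' + B\<close> satisfies \<open>Re W \<rightarrow> 0\<close>. With
  \<open>a = Re A\<close> the form of \<open>u\<close> becomes \<open>u = a - y a\<^sub>y + y Re W\<close>, whence \<open>(a/y)\<^sub>y = O(1/y)\<close>
  and finally \<open>a \<rightarrow> 0\<close>. In the four other cases \<open>\<Delta>u\<close> or its normal derivative is
  prescribed, so \<open>B\<close> continues first, and the remaining condition then decides about \<open>A\<close>.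

  All this happens on convex neighbourhoods, symmetric in the line, of vertical segments. Each
  one contains the whole segment that enters the formula, so the formula is verified inside a
  single neighbourhood, and the identity theorem makes the local continuations agree
  (\<open>goursat_uniqueness\<close>, \<open>continuation_from_local\<close>).\<close>

section \<open>Partial derivatives and the classes \<open>C^k\<close> in the plane\<close>

lemma dx_cong:
  assumes "open S" "p \<in> S" "\<And>q. q \<in> S \<Longrightarrow> f q = g q"
  shows "dx f p = dx g p"
proof -
  have "eventually (\<lambda>t. (t, snd p) \<in> S) (nhds (fst p))"
  proof -
    have "((\<lambda>t. (t, snd p)) \<longlongrightarrow> (fst p, snd p)) (nhds (fst p))"
      by (intro tendsto_intros filterlim_ident)
    then show ?thesis
      using assms(1,2) by (simp add: tendsto_def)
  qed
  then show ?thesis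
    unfolding dx_def by (intro deriv_cong_ev refl) (auto elim!: eventually_mono intro: assms(3))
qed

lemma dy_cong:
  assumes "open S" "p \<in> S" "\<And>q. q \<in> S \<Longrightarrow> f q = g q"
  shows "dy f p = dy g p"
proof -
  have "eventually (\<lambda>t. (fst p, t) \<in> S) (nhds (snd p))"
  proof -
    have "((\<lambda>t. (fst p, t)) \<longlongrightarrow> (fst p, snd p)) (nhds (snd p))"
      by (intro tendsto_intros filterlim_ident)
    then show ?thesis
      using assms(1,2) by (simp add: tendsto_def)
  qed
  then show ?thesis
    unfolding dy_def by (intro deriv_cong_ev refl) (auto elim!: eventually_mono intro: assms(3))
qed

lemma laplacian_cong:
  assumes "open S" "p \<in> S" "\<And>q. q \<in> S \<Longrightarrow> f q = g q"
  shows "laplacian f p = laplacian g p"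
proof -
  have "dx (dx f) p = dx (dx g) p"
    by (rule dx_cong[OF assms(1,2)]) (rule dx_cong[OF assms(1)], auto intro: assms(3))
  moreover have "dy (dy f) p = dy (dy g) p"
    by (rule dy_cong[OF assms(1,2)]) (rule dy_cong[OF assms(1)], auto intro: assms(3))
  ultimately show ?thesis by (simp add: laplacian_def)
qed

lemma Ck_on_cong:
  assumes "open S" "\<And>q. q \<in> S \<Longrightarrow> f q = g q"
  shows "Ck_on k S f \<longleftrightarrow> Ck_on k S g"
  using assms(2)
proof (induction k arbitrary: f g)
  case 0
  then show ?case by (simp cong: continuous_on_cong)
next
  case (Suc k)
  have "f differentiable_on S \<longleftrightarrow> g differentiable_on S"
    using Suc.prems unfolding differentiable_on_def differentiable_def
    by (metis has_derivative_transform)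
  moreover have "Ck_on k S (dx f) \<longleftrightarrow> Ck_on k S (dx g)"
    by (intro Suc.IH dx_cong[OF assms(1)]) (auto intro: Suc.prems)
  moreover have "Ck_on k S (dy f) \<longleftrightarrow> Ck_on k S (dy g)"
    by (intro Suc.IH dy_cong[OF assms(1)]) (auto intro: Suc.prems)
  ultimately show ?case by simp
qed

lemma Ck_on_subset: "Ck_on k S f \<Longrightarrow> T \<subseteq> S \<Longrightarrow> Ck_on k T f"
  by (induction k arbitrary: f) (auto intro: continuous_on_subset differentiable_on_subset)

lemma Ck_on_SucD: "Ck_on (Suc k) S f \<Longrightarrow> Ck_on k S f"
proof (induction k arbitrary: f)
  case 0
  then show ?case by (simp add: differentiable_imp_continuous_on)
next
  case (Suc k)
  have "f differentiable_on S" "Ck_on (Suc k) S (dx f)" "Ck_on (Suc k) S (dy f)"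
    using iffD1[OF Ck_on.simps(2) Suc.prems] by auto
  have "Ck_on k S (dx f)" "Ck_on k S (dy f)"
    by (rule Suc.IH, fact)+
  with \<open>f differentiable_on S\<close> show ?case by simp
qed

lemma Ck_on_locally:
  assumes "\<And>p. p \<in> S \<Longrightarrow> \<exists>T. open T \<and> p \<in> T \<and> Ck_on k T f"
  shows "Ck_on k S f"
  using assms
proof (induction k arbitrary: f)
  case 0
  then show ?case
    unfolding Ck_on.simps
    by (intro continuous_at_imp_continuous_on ballI) (meson continuous_on_eq_continuous_at)
next
  case (Suc k)
  have "f differentiable_on S"
    unfolding differentiable_on_def
  proof
    fix p assume "p \<in> S"
    then obtain T where "open T" "p \<in> T" "Ck_on (Suc k) T f"
      using Suc.prems by blast
    then have "f differentiable (at p)"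
      by (simp add: differentiable_on_eq_differentiable_at)
    then show "f differentiable at p within S"
      by (rule differentiable_at_withinI)
  qed
  moreover have "Ck_on k S (dx f)" "Ck_on k S (dy f)"
    using Suc.prems by (fastforce intro!: Suc.IH)+
  ultimately show ?case by simp
qed

lemma partials_of_derivative:
  assumes "(f has_derivative (\<lambda>h. fst h * a + snd h * b)) (at p)"
  shows "((\<lambda>t. f (t, snd p)) has_real_derivative a) (at (fst p))"
    and "((\<lambda>t. f (fst p, t)) has_real_derivative b) (at (snd p))"
    and "dx f p = a" and "dy f p = b"
proof -
  show 1: "((\<lambda>t. f (t, snd p)) has_real_derivative a) (at (fst p))"
  proof -
    have "((\<lambda>t. (t, snd p)) has_derivative (\<lambda>t. (t, 0))) (at (fst p))"
      by (intro derivative_eq_intros) auto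
    from has_derivative_compose[OF this, of f "\<lambda>h. fst h * a + snd h * b"] assms
    have "((\<lambda>t. f (t, snd p)) has_derivative (\<lambda>t. t * a)) (at (fst p))"
      by simp
    then show ?thesis
      by (simp add: has_field_derivative_def mult_commute_abs)
  qed
  show 2: "((\<lambda>t. f (fst p, t)) has_real_derivative b) (at (snd p))"
  proof -
    have "((\<lambda>t. (fst p, t)) has_derivative (\<lambda>t. (0, t))) (at (snd p))"
      by (intro derivative_eq_intros) auto
    from has_derivative_compose[OF this, of f "\<lambda>h. fst h * a + snd h * b"] assms
    have "((\<lambda>t. f (fst p, t)) has_derivative (\<lambda>t. t * b)) (at (snd p))"
      by simp
    then show ?thesis
      by (simp add: has_field_derivative_def mult_commute_abs)
  qed
  show "dx f p = a" "dy f p = b"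
    using 1 2 by (auto simp: dx_def dy_def intro: DERIV_imp_deriv)
qed

lemma derivative_by_partials:
  assumes "f differentiable_on S" "open S" "p \<in> S"
  shows "(f has_derivative (\<lambda>h. fst h * dx f p + snd h * dy f p)) (at p)"
proof -
  obtain D where D: "(f has_derivative D) (at p)"
    using assms by (metis differentiable_def differentiable_on_eq_differentiable_at)
  interpret linear D
    using D by (rule has_derivative_linear)
  have "D h = fst h * D (1, 0) + snd h * D (0, 1)" for h
  proof -
    have "h = fst h *\<^sub>R (1, 0) + snd h *\<^sub>R (0, 1)"
      by (simp add: prod_eq_iff)
    then have "D h = D (fst h *\<^sub>R (1, 0) + snd h *\<^sub>R (0, 1))"
      by simp
    then show ?thesis
      by (simp only: add scale real_scaleR_def)
  qed
  then have "D = (\<lambda>h. fst h * D (1, 0) + snd h * D (0, 1))" by blast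
  with D partials_of_derivative(3,4)[of f "D (1,0)" "D (0,1)" p] show ?thesis by metis
qed

lemma partials_add_scaled:
  assumes "f differentiable_on S" "g differentiable_on S" "open S" "p \<in> S"
  shows "dx (\<lambda>q. f q + c * g q) p = dx f p + c * dx g p"
    and "dy (\<lambda>q. f q + c * g q) p = dy f p + c * dy g p"
proof -
  have "((\<lambda>q. f q + c * g q) has_derivative
      (\<lambda>h. fst h * (dx f p + c * dx g p) + snd h * (dy f p + c * dy g p))) (at p)"
    by (rule derivative_eq_intros derivative_by_partials assms refl)+ (auto simp: algebra_simps)
  from partials_of_derivative(3,4)[OF this]
  show "dx (\<lambda>q. f q + c * g q) p = dx f p + c * dx g p"
    and "dy (\<lambda>q. f q + c * g q) p = dy f p + c * dy g p" .
qed

lemma Ck_on_add_scaled: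
  assumes "open S" "Ck_on k S f" "Ck_on k S g"
  shows "Ck_on k S (\<lambda>q. f q + c * g q)"
  using assms(2,3)
proof (induction k arbitrary: f g)
  case 0
  then show ?case by (auto intro!: continuous_intros)
next
  case (Suc k)
  then have d: "f differentiable_on S" "g differentiable_on S" by auto
  have "Ck_on k S (dx (\<lambda>q. f q + c * g q))"
    using Suc Ck_on_cong[OF assms(1) partials_add_scaled(1)[OF d assms(1)]] by auto
  moreover have "Ck_on k S (dy (\<lambda>q. f q + c * g q))"
    using Suc Ck_on_cong[OF assms(1) partials_add_scaled(2)[OF d assms(1)]] by auto
  moreover have "(\<lambda>q. f q + c * g q) differentiable_on S"
    using d by (auto intro!: derivative_intros)
  ultimately show ?case by simp
qed

lemma laplacian_add_scaled:
  assumes "open S" "Ck_on 2 S f" "Ck_on 2 S g" "p \<in> S"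
  shows "laplacian (\<lambda>q. f q + c * g q) p = laplacian f p + c * laplacian g p"
proof -
  have d: "f differentiable_on S" "g differentiable_on S"
    "dx f differentiable_on S" "dx g differentiable_on S"
    "dy f differentiable_on S" "dy g differentiable_on S"
    using assms(2,3) by (auto simp: numeral_2_eq_2)
  have "dx (dx (\<lambda>q. f q + c * g q)) p = dx (\<lambda>q. dx f q + c * dx g q) p"
    by (rule dx_cong[OF assms(1,4)]) (rule partials_add_scaled(1)[OF d(1,2) assms(1)])
  moreover have "dy (dy (\<lambda>q. f q + c * g q)) p = dy (\<lambda>q. dy f q + c * dy g q) p"
    by (rule dy_cong[OF assms(1,4)]) (rule partials_add_scaled(2)[OF d(1,2) assms(1)])
  ultimately show ?thesis
    using partials_add_scaled(1)[OF d(3,4) assms(1,4)] partials_add_scaled(2)[OF d(5,6) assms(1,4)]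
    by (simp add: laplacian_def algebra_simps)
qed

lemma Ck_on_laplacian:
  assumes "open S" "Ck_on (Suc (Suc k)) S f"
  shows "Ck_on k S (laplacian f)"
proof -
  have "Ck_on k S (\<lambda>q. dx (dx f) q + 1 * dy (dy f) q)"
    using assms by (intro Ck_on_add_scaled) auto
  then show ?thesis by (simp add: laplacian_def[abs_def])
qed

text \<open>The second difference of \<open>f\<close> over a small square with side \<open>s\<close> is \<open>s\<^sup>2\<close> times either mixed
  partial derivative at some point of the square: apply the mean value theorem twice, in either
  order. Continuity at \<open>p\<close> excludes two different limits.\<close>

lemma mixed_partials_eq:
  assumes "open S" "Ck_on 2 S f" "p \<in> S"
  shows "dx (dy f) p = dy (dx f) p"
proof (rule ccontr)
  assume ne: "dx (dy f) p \<noteq> dy (dx f) p"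
  define e where "e = \<bar>dx (dy f) p - dy (dx f) p\<bar> / 2"
  have e: "e > 0" using ne by (simp add: e_def)
  have d: "f differentiable_on S" "dx f differentiable_on S" "dy f differentiable_on S"
    and c: "continuous_on S (dx (dy f))" "continuous_on S (dy (dx f))"
    using assms(2) by (auto simp: numeral_2_eq_2)
  obtain d1 where d1: "d1 > 0" "\<And>q. dist q p < d1 \<Longrightarrow> q \<in> S"
    using assms(1,3) by (meson open_dist)
  obtain d2 where d2: "d2 > 0" "\<And>q. q \<in> S \<Longrightarrow> dist q p < d2 \<Longrightarrow> dist (dx (dy f) q) (dx (dy f) p) < e"
    using c(1) assms(3) e unfolding continuous_on_iff by metis
  obtain d3 where d3: "d3 > 0" "\<And>q. q \<in> S \<Longrightarrow> dist q p < d3 \<Longrightarrow> dist (dy (dx f) q) (dy (dx f) p) < e"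
    using c(2) assms(3) e unfolding continuous_on_iff by metis
  \<comment> \<open>Points of the square with corner \<open>p\<close> and side \<open>s\<close> have distance at most \<open>2s\<close> from \<open>p\<close>.\<close>
  define s where "s = min d1 (min d2 d3) / 3"
  have s: "s > 0" using d1 d2 d3 by (simp add: s_def)
  obtain x y where p: "p = (x, y)" by (cases p)
  have near: "dist (x', y') p < d1" "dist (x', y') p < d2" "dist (x', y') p < d3"
    if "x \<le> x'" "x' \<le> x + s" "y \<le> y'" "y' \<le> y + s" for x' y'
  proof -
    have "dist (x', y') p \<le> \<bar>x' - x\<bar> + \<bar>y' - y\<bar>"
      by (simp add: p dist_Pair_Pair dist_real_def sqrt_sum_squares_le_sum_abs)
    also have "\<dots> \<le> 2 * s" using that by simp
    also have "\<dots> < min d1 (min d2 d3)" using d1 d2 d3 by (auto simp: s_def min_def)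
    finally show "dist (x', y') p < d1" "dist (x', y') p < d2" "dist (x', y') p < d3" by auto
  qed
  note inS = d1(2)[OF near(1)]
  have fx: "((\<lambda>t. g (t, y')) has_real_derivative dx g (x', y')) (at x')"
    if "g differentiable_on S" "x \<le> x'" "x' \<le> x + s" "y \<le> y'" "y' \<le> y + s" for g x' y'
    using partials_of_derivative(1)[OF derivative_by_partials[OF that(1) assms(1) inS[OF that(2-5)]]]
    by simp
  have fy: "((\<lambda>t. g (x', t)) has_real_derivative dy g (x', y')) (at y')"
    if "g differentiable_on S" "x \<le> x'" "x' \<le> x + s" "y \<le> y'" "y' \<le> y + s" for g x' y'
    using partials_of_derivative(2)[OF derivative_by_partials[OF that(1) assms(1) inS[OF that(2-5)]]]
    by simp
  define \<Delta> where "\<Delta> = f (x + s, y + s) - f (x + s, y) - f (x, y + s) + f (x, y)"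
  have "\<exists>a b. x \<le> a \<and> a \<le> x + s \<and> y \<le> b \<and> b \<le> y + s \<and> \<Delta> = s * (s * dy (dx f) (a, b))"
  proof -
    have "\<exists>a. a > x \<and> a < x + s \<and> (f (x + s, y + s) - f (x + s, y)) - (f (x, y + s) - f (x, y))
        = (x + s - x) * (dx f (a, y + s) - dx f (a, y))"
      using s d by (intro MVT2) (auto intro!: derivative_intros fx)
    then obtain a where a: "a > x" "a < x + s" "\<Delta> = s * (dx f (a, y + s) - dx f (a, y))"
      by (auto simp: \<Delta>_def)
    have "\<exists>b. b > y \<and> b < y + s \<and> dx f (a, y + s) - dx f (a, y) = (y + s - y) * dy (dx f) (a, b)"
      using s d a by (intro MVT2) (auto intro!: fy)
    then obtain b where "b > y" "b < y + s" "dx f (a, y + s) - dx f (a, y) = s * dy (dx f) (a, b)"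
      by auto
    with a show ?thesis by (intro exI[of _ a] exI[of _ b]) auto
  qed
  then obtain a b where ab: "x \<le> a" "a \<le> x + s" "y \<le> b" "b \<le> y + s" "\<Delta> = s * (s * dy (dx f) (a, b))"
    by blast
  have "\<exists>a b. x \<le> a \<and> a \<le> x + s \<and> y \<le> b \<and> b \<le> y + s \<and> \<Delta> = s * (s * dx (dy f) (a, b))"
  proof -
    have "\<exists>b. b > y \<and> b < y + s \<and> (f (x + s, y + s) - f (x, y + s)) - (f (x + s, y) - f (x, y))
        = (y + s - y) * (dy f (x + s, b) - dy f (x, b))"
      using s d by (intro MVT2) (auto intro!: derivative_intros fy)
    then obtain b where b: "b > y" "b < y + s" "\<Delta> = s * (dy f (x + s, b) - dy f (x, b))"
      by (auto simp: \<Delta>_def)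
    have "\<exists>a. a > x \<and> a < x + s \<and> dy f (x + s, b) - dy f (x, b) = (x + s - x) * dx (dy f) (a, b)"
      using s d b by (intro MVT2) (auto intro!: fx)
    then obtain a where "a > x" "a < x + s" "dy f (x + s, b) - dy f (x, b) = s * dx (dy f) (a, b)"
      by auto
    with b show ?thesis by (intro exI[of _ a] exI[of _ b]) auto
  qed
  then obtain a' b' where ab': "x \<le> a'" "a' \<le> x + s" "y \<le> b'" "b' \<le> y + s" "\<Delta> = s * (s * dx (dy f) (a', b'))"
    by blast
  have "dy (dx f) (a, b) = dx (dy f) (a', b')"
    using ab(5) ab'(5) s by simp
  moreover have "dist (dy (dx f) (a, b)) (dy (dx f) p) < e"
    by (intro d3 inS near ab)
  moreover have "dist (dx (dy f) (a', b')) (dx (dy f) p) < e"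
    by (intro d2 inS near ab')
  ultimately show False
    by (simp add: e_def dist_real_def abs_if field_simps split: if_splits)
qed

section \<open>Goursat's representation of biharmonic functions\<close>

definition cpx :: "real \<times> real \<Rightarrow> complex" where
  "cpx p = Complex (fst p) (snd p)"

lemma cpx_simps [simp]: "Re (cpx p) = fst p" "Im (cpx p) = snd p" "cpx (Re z, Im z) = z"
  by (simp_all add: cpx_def)

lemma has_derivative_cpx: "(cpx has_derivative cpx) F"
proof -
  have eq: "cpx = (\<lambda>p. of_real (fst p) + \<i> * of_real (snd p))"
    by (simp add: fun_eq_iff cpx_def complex_eq_iff)
  show ?thesis unfolding eq
    by (rule derivative_eq_intros refl)+
qed

lemma linear_cpx: "linear cpx"
  using has_derivative_cpx has_derivative_linear by blast

lemma open_vimage_cpx: "open T \<Longrightarrow> open (cpx -` T)"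
proof (rule open_vimage)
  show "continuous_on UNIV cpx"
    using has_derivative_cpx has_derivative_continuous
    by (metis continuous_at_imp_continuous_on)
qed

lemma convex_vimage_cpx: "convex T \<Longrightarrow> convex (cpx -` T)"
  using convex_linear_vimage linear_cpx by blast

text \<open>Goursat's general biharmonic function \<open>Re (f + cnj z g)\<close>, with \<open>cnj z = z - 2\<i>y\<close> used to let the
  coordinate \<open>y\<close> be the only factor that is not holomorphic. Differentiation then maps the class
  to itself.\<close>

definition goursat :: "(complex \<Rightarrow> complex) \<Rightarrow> (complex \<Rightarrow> complex) \<Rightarrow> real \<times> real \<Rightarrow> real" where
  "goursat A B p = Re (A (cpx p)) + snd p * Re (B (cpx p))"

lemma has_derivative_goursat:
  assumes "A holomorphic_on T" "B holomorphic_on T" "open T" "cpx p \<in> T"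
  shows "(goursat A B has_derivative (\<lambda>h. fst h * goursat (deriv A) (deriv B) p +
      snd h * goursat (\<lambda>z. \<i> * deriv A z + B z) (\<lambda>z. \<i> * deriv B z) p)) (at p)"
proof -
  have *: "((\<lambda>q. Re (F (cpx q))) has_derivative (\<lambda>h. Re (deriv F (cpx p) * cpx h))) (at p)"
    if "F holomorphic_on T" for F
  proof -
    have "(F has_field_derivative deriv F (cpx p)) (at (cpx p))"
      using that assms holomorphic_derivI by blast
    then have "((\<lambda>q. F (cpx q)) has_derivative (\<lambda>h. deriv F (cpx p) * cpx h)) (at p)"
      using has_derivative_compose[OF has_derivative_cpx, of F "(*) (deriv F (cpx p))" p UNIV]
      by (simp add: has_field_derivative_def)
    then show ?thesis by (rule has_derivative_Re)
  qed
  show ?thesis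
    unfolding goursat_def
    by (rule has_derivative_eq_rhs,
        rule has_derivative_add[OF *[OF assms(1)] has_derivative_mult[OF has_derivative_snd[OF has_derivative_ident] *[OF assms(2)]]])
      (auto simp: fun_eq_iff goursat_def algebra_simps)
qed

lemma partials_goursat:
  assumes "A holomorphic_on T" "B holomorphic_on T" "open T" "cpx p \<in> T"
  shows "dx (goursat A B) p = goursat (deriv A) (deriv B) p"
    and "dy (goursat A B) p = goursat (\<lambda>z. \<i> * deriv A z + B z) (\<lambda>z. \<i> * deriv B z) p"
  using partials_of_derivative[OF has_derivative_goursat[OF assms]] by auto

lemma Ck_on_goursat:
  assumes "A holomorphic_on T" "B holomorphic_on T" "open T"
  shows "Ck_on k (cpx -` T) (goursat A B)"
  using assms(1,2)
proof (induction k arbitrary: A B)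
  case 0
  then show ?case unfolding Ck_on.simps
    using has_derivative_goursat[OF 0 assms(3)]
    by (intro continuous_at_imp_continuous_on) (auto intro: has_derivative_continuous)
next
  case (Suc k)
  have d: "deriv A holomorphic_on T" "deriv B holomorphic_on T"
    using Suc.prems assms(3) by (auto intro: holomorphic_deriv)
  have "Ck_on k (cpx -` T) (dx (goursat A B))"
    using Ck_on_cong[OF open_vimage_cpx[OF assms(3)], of "dx (goursat A B)" "goursat (deriv A) (deriv B)" k]
      partials_goursat(1)[OF Suc.prems assms(3)] Suc.IH[OF d] by auto
  moreover have "Ck_on k (cpx -` T) (goursat (\<lambda>z. \<i> * deriv A z + B z) (\<lambda>z. \<i> * deriv B z))"
    using Suc.prems d assms(3) by (intro Suc.IH holomorphic_intros) auto
  then have "Ck_on k (cpx -` T) (dy (goursat A B))"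
    using Ck_on_cong[OF open_vimage_cpx[OF assms(3)], of "dy (goursat A B)" "goursat (\<lambda>z. \<i> * deriv A z + B z) (\<lambda>z. \<i> * deriv B z)" k]
      partials_goursat(2)[OF Suc.prems assms(3)] by auto
  moreover have "goursat A B differentiable_on (cpx -` T)"
    using has_derivative_goursat[OF Suc.prems assms(3)]
    by (auto simp: differentiable_on_def differentiable_def intro: has_derivative_at_withinI)
  ultimately show ?case by simp
qed

lemma laplacian_goursat:
  assumes "A holomorphic_on T" "B holomorphic_on T" "open T" "cpx p \<in> T"
  shows "laplacian (goursat A B) p = 2 * Re (\<i> * deriv B (cpx p))"
proof -
  note S = open_vimage_cpx[OF assms(3)]
  have p: "p \<in> cpx -` T" using assms by simp
  have d: "deriv A holomorphic_on T" "deriv B holomorphic_on T"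
    using assms by (auto intro: holomorphic_deriv)
  have dA: "(deriv A has_field_derivative deriv (deriv A) z) (at z)"
    and dB: "(deriv B has_field_derivative deriv (deriv B) z) (at z)"
    and dB': "(B has_field_derivative deriv B z) (at z)" if "z \<in> T" for z
    using d assms that by (auto intro: holomorphic_derivI)
  have "dx (dx (goursat A B)) p = dx (goursat (deriv A) (deriv B)) p"
    by (rule dx_cong[OF S p]) (use partials_goursat(1)[OF assms(1-3)] in auto)
  also have "\<dots> = goursat (deriv (deriv A)) (deriv (deriv B)) p"
    by (rule partials_goursat(1)[OF d assms(3,4)])
  finally have 1: "dx (dx (goursat A B)) p = \<dots>" .
  have "dy (dy (goursat A B)) p = dy (goursat (\<lambda>z. \<i> * deriv A z + B z) (\<lambda>z. \<i> * deriv B z)) p"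
    by (rule dy_cong[OF S p]) (use partials_goursat(2)[OF assms(1-3)] in auto)
  also have "\<dots> = goursat (\<lambda>z. \<i> * deriv (\<lambda>z. \<i> * deriv A z + B z) z + \<i> * deriv B z)
      (\<lambda>z. \<i> * deriv (\<lambda>z. \<i> * deriv B z) z) p"
    using d assms by (intro partials_goursat(2)[OF _ _ assms(3,4)] holomorphic_intros) auto
  finally have 2: "dy (dy (goursat A B)) p = \<dots>" .
  have "deriv (\<lambda>z. \<i> * deriv A z + B z) (cpx p) = \<i> * deriv (deriv A) (cpx p) + deriv B (cpx p)"
    by (rule DERIV_imp_deriv) (rule derivative_eq_intros dA dB' assms refl | simp)+
  moreover have "deriv (\<lambda>z. \<i> * deriv B z) (cpx p) = \<i> * deriv (deriv B) (cpx p)"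
    by (rule DERIV_imp_deriv) (rule derivative_eq_intros dB assms refl | simp)+
  ultimately show ?thesis
    unfolding laplacian_def 1 2 by (simp add: goursat_def)
qed

lemma laplacian_goursat_as_goursat:
  assumes "A holomorphic_on T" "B holomorphic_on T" "open T" "cpx p \<in> T"
  shows "laplacian (goursat A B) p = goursat (\<lambda>z. 2 * \<i> * deriv B z) (\<lambda>z. 0) p"
  using laplacian_goursat[OF assms] by (simp add: goursat_def)

lemma biharmonic_on_goursat:
  assumes "A holomorphic_on T" "B holomorphic_on T" "open T"
  shows "biharmonic_on (cpx -` T) (goursat A B)"
  unfolding biharmonic_on_def
proof (intro conjI ballI Ck_on_goursat assms)
  fix p assume p: "p \<in> cpx -` T"
  have "deriv B holomorphic_on T" using assms by (auto intro: holomorphic_deriv)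
  then have "laplacian (goursat (\<lambda>z. 2 * \<i> * deriv B z) (\<lambda>z. 0)) p = 0"
    using laplacian_goursat[of "\<lambda>z. 2 * \<i> * deriv B z" T "\<lambda>z. 0" p] assms(3) p
    by (simp add: holomorphic_intros)
  moreover have "laplacian (laplacian (goursat A B)) p = laplacian (goursat (\<lambda>z. 2 * \<i> * deriv B z) (\<lambda>z. 0)) p"
    by (rule laplacian_cong[OF open_vimage_cpx[OF assms(3)] p]) (use laplacian_goursat_as_goursat[OF assms] in auto)
  ultimately show "laplacian (laplacian (goursat A B)) p = 0" by simp
qed

lemma holomorphic_primitive:
  assumes "f holomorphic_on T" "convex T" "open T"
  shows "\<exists>F. F holomorphic_on T \<and> (\<forall>z\<in>T. (F has_field_derivative f z) (at z))"
proof -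
  obtain F where "\<And>z. z \<in> T \<Longrightarrow> (F has_field_derivative f z) (at z within T)"
    using holomorphic_convex_primitive'[OF assms(2,3,1)] by blast
  then have "\<And>z. z \<in> T \<Longrightarrow> (F has_field_derivative f z) (at z)"
    using at_within_open[OF _ assms(3)] by metis
  moreover from this have "F holomorphic_on T"
    using holomorphic_on_open[OF assms(3)] by metis
  ultimately show ?thesis by blast
qed

text \<open>The function \<open>\<partial>\<^sub>x h - \<i> \<partial>\<^sub>y h\<close> satisfies the Cauchy-Riemann equations because \<open>h\<close> is harmonic and
  its mixed derivatives agree. Convexity supplies a primitive of it, whose real part has the
  gradient of \<open>h\<close>.\<close>

lemma harmonic_is_Re:
  assumes T: "open T" "convex T" and h: "Ck_on 2 (cpx -` T) h" "\<And>p. p \<in> cpx -` T \<Longrightarrow> laplacian h p = 0"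
  obtains F where "F holomorphic_on T" "\<And>p. p \<in> cpx -` T \<Longrightarrow> h p = Re (F (cpx p))"
proof -
  define S where "S = cpx -` T"
  have S: "open S" "convex S"
    using T open_vimage_cpx convex_vimage_cpx by (auto simp: S_def)
  have d: "h differentiable_on S" "dx h differentiable_on S" "dy h differentiable_on S"
    using h(1) by (auto simp: numeral_2_eq_2 S_def)
  define f where "f = (\<lambda>z. Complex (dx h (Re z, Im z)) (- dy h (Re z, Im z)))"
  have "(f has_field_derivative Complex (dx (dx h) (Re z, Im z)) (- dy (dx h) (Re z, Im z))) (at z)"
    if z: "z \<in> T" for z
  proof -
    define p where "p = (Re z, Im z)"
    have p: "p \<in> S" using z by (simp add: p_def S_def)
    have pt: "((\<lambda>z. (Re z, Im z)) has_derivative (\<lambda>z. (Re z, Im z))) (at z)"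
      by (intro derivative_intros has_derivative_Re has_derivative_Im)
    have 1: "((\<lambda>z. dx h (Re z, Im z)) has_derivative (\<lambda>k. Re k * dx (dx h) p + Im k * dy (dx h) p)) (at z)"
      using has_derivative_compose[OF pt, of "dx h" "\<lambda>k. fst k * dx (dx h) p + snd k * dy (dx h) p"] derivative_by_partials[OF d(2) S(1) p]
      by (simp add: p_def)
    have 2: "((\<lambda>z. dy h (Re z, Im z)) has_derivative (\<lambda>k. Re k * dx (dy h) p + Im k * dy (dy h) p)) (at z)"
      using has_derivative_compose[OF pt, of "dy h" "\<lambda>k. fst k * dx (dy h) p + snd k * dy (dy h) p"] derivative_by_partials[OF d(3) S(1) p]
      by (simp add: p_def)
    have m: "dx (dy h) p = dy (dx h) p"
      using mixed_partials_eq S(1) h(1) p unfolding S_def by blast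
    have l: "dy (dy h) p = - dx (dx h) p"
      using h(2)[of p] p by (simp add: laplacian_def S_def)
    have f: "f = (\<lambda>z. of_real (dx h (Re z, Im z)) + \<i> * of_real (- dy h (Re z, Im z)))"
      by (simp add: f_def fun_eq_iff complex_eq_iff)
    have "(f has_derivative (\<lambda>k. of_real (Re k * dx (dx h) p + Im k * dy (dx h) p)
          + \<i> * of_real (- (Re k * dx (dy h) p + Im k * dy (dy h) p)))) (at z)"
      unfolding f by (intro derivative_intros 1 2)
    also have "(\<lambda>k. of_real (Re k * dx (dx h) p + Im k * dy (dx h) p)
          + \<i> * of_real (- (Re k * dx (dy h) p + Im k * dy (dy h) p)))
        = (*) (Complex (dx (dx h) p) (- dy (dx h) p))"
      by (auto simp: fun_eq_iff complex_eq_iff m l algebra_simps)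
    finally show ?thesis by (simp add: has_field_derivative_def p_def)
  qed
  then have "f holomorphic_on T"
    using T(1) holomorphic_on_open by blast
  then obtain G where G: "G holomorphic_on T" "\<And>z. z \<in> T \<Longrightarrow> (G has_field_derivative f z) (at z)"
    using holomorphic_primitive[OF _ T(2,1)] by blast
  have "\<exists>c. \<forall>p\<in>S. h p - Re (G (cpx p)) = c"
  proof (rule has_derivative_zero_constant[OF S(2)])
    fix p assume p: "p \<in> S"
    have "((\<lambda>q. G (cpx q)) has_derivative (\<lambda>k. f (cpx p) * cpx k)) (at p)"
      using has_derivative_compose[OF has_derivative_cpx, of G "(*) (f (cpx p))" p UNIV] G(2)[of "cpx p"] p
      by (simp add: S_def has_field_derivative_def)
    then have "((\<lambda>q. h q - Re (G (cpx q))) has_derivative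
       (\<lambda>k. (fst k * dx h p + snd k * dy h p) - Re (f (cpx p) * cpx k))) (at p)"
      by (intro derivative_intros has_derivative_Re derivative_by_partials[OF d(1) S(1) p])
    moreover have "fst k * dx h p + snd k * dy h p - Re (f (cpx p) * cpx k) = 0" for k
      by (simp add: f_def algebra_simps)
    ultimately show "((\<lambda>q. h q - Re (G (cpx q))) has_derivative (\<lambda>k. 0)) (at p within S)"
      by (simp only: has_derivative_at_withinI)
  qed
  then obtain c where c: "\<And>p. p \<in> S \<Longrightarrow> h p - Re (G (cpx p)) = c" by blast
  show ?thesis
  proof (rule that[of "\<lambda>z. G z + of_real c"])
    show "(\<lambda>z. G z + of_real c) holomorphic_on T"
      using G(1) by (intro holomorphic_intros)
    show "h p = Re (G (cpx p) + of_real c)" if "p \<in> cpx -` T" for p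
      using c[of p] that by (simp add: S_def)
  qed
qed

text \<open>The harmonic function \<open>\<Delta>u\<close> is some \<open>Re G\<close>. Choosing \<open>B\<close> with \<open>B' = - \<i>G/2\<close> makes the Laplacian
  of \<open>y Re B\<close> equal to \<open>\<Delta>u\<close>, and the rest of \<open>u\<close> is harmonic.\<close>

lemma biharmonic_is_goursat:
  assumes T: "open T" "convex T" and u: "biharmonic_on (cpx -` T) u"
  obtains A B where "A holomorphic_on T" "B holomorphic_on T"
    "\<And>p. p \<in> cpx -` T \<Longrightarrow> u p = goursat A B p"
proof -
  define S where "S = cpx -` T"
  have S: "open S" using T open_vimage_cpx by (auto simp: S_def)
  have C: "Ck_on (Suc (Suc 2)) S u" using u by (simp add: biharmonic_on_def S_def eval_nat_numeral)
  then have C2: "Ck_on 2 S (laplacian u)" by (rule Ck_on_laplacian[OF S])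
  have C2': "Ck_on 2 S u"
    by (rule Ck_on_SucD, rule Ck_on_SucD, rule C)
  obtain G where G: "G holomorphic_on T" "\<And>p. p \<in> S \<Longrightarrow> laplacian u p = Re (G (cpx p))"
    using harmonic_is_Re[OF T, of "laplacian u"] C2 u unfolding biharmonic_on_def S_def by blast
  have "(\<lambda>z. - \<i> * G z / 2) holomorphic_on T" using G(1) by (intro holomorphic_intros) auto
  then obtain B where B: "B holomorphic_on T" "\<And>z. z \<in> T \<Longrightarrow> (B has_field_derivative - \<i> * G z / 2) (at z)"
    using holomorphic_primitive[OF _ T(2,1)] by blast
  have gB: "Ck_on 2 S (goursat (\<lambda>_. 0) B)"
    unfolding S_def by (intro Ck_on_goursat B T holomorphic_intros)
  have "Ck_on 2 S (\<lambda>p. u p + (-1) * goursat (\<lambda>_. 0) B p)"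
    by (rule Ck_on_add_scaled[OF S C2' gB])
  moreover have "laplacian (\<lambda>p. u p + (-1) * goursat (\<lambda>_. 0) B p) p = 0" if p: "p \<in> S" for p
  proof -
    have "laplacian (goursat (\<lambda>_. 0) B) p = 2 * Re (\<i> * deriv B (cpx p))"
      using p by (intro laplacian_goursat[OF _ B(1) T(1)]) (auto simp: S_def)
    moreover have "deriv B (cpx p) = - \<i> * G (cpx p) / 2"
      using p B(2) by (auto simp: S_def intro: DERIV_imp_deriv)
    ultimately show ?thesis
      using laplacian_add_scaled[OF S C2' gB p, of "-1"] G(2)[OF p] by simp
  qed
  ultimately obtain A where "A holomorphic_on T" "\<And>p. p \<in> S \<Longrightarrow> u p + (-1) * goursat (\<lambda>_. 0) B p = Re (A (cpx p))"
    using harmonic_is_Re[OF T, of "\<lambda>p. u p + (-1) * goursat (\<lambda>_. 0) B p"] unfolding S_def by blast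
  then show ?thesis
    using that[of A B] B(1) by (force simp: goursat_def S_def)
qed

section \<open>Schwarz reflection when only the real part is known to vanish\<close>

lemma has_vector_derivative_vertical:
  assumes "(F has_field_derivative d) (at (Complex x t))"
  shows "((\<lambda>t. F (Complex x t)) has_vector_derivative \<i> * d) (at t)"
proof -
  have eq: "Complex x = (\<lambda>t. of_real x + \<i> * of_real t)"
    by (simp add: fun_eq_iff complex_eq_iff)
  have "(Complex x has_vector_derivative \<i>) (at t)"
    unfolding eq has_vector_derivative_def
    by (auto intro!: derivative_eq_intros simp: scaleR_conv_of_real)
  from field_vector_diff_chain_at[OF this assms] show ?thesis
    by (simp add: o_def)
qed

lemma has_vector_derivative_horizontal:
  assumes "(F has_field_derivative d) (at (Complex t y))"
  shows "((\<lambda>t. F (Complex t y)) has_vector_derivative d) (at t)"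
proof -
  have eq: "(\<lambda>t. Complex t y) = (\<lambda>t. of_real t + \<i> * of_real y)"
    by (simp add: fun_eq_iff complex_eq_iff)
  have "((\<lambda>t. Complex t y) has_vector_derivative 1) (at t)"
    unfolding eq has_vector_derivative_def
    by (auto intro!: derivative_eq_intros simp: scaleR_conv_of_real)
  from field_vector_diff_chain_at[OF this assms] show ?thesis
    by (simp add: o_def)
qed

lemma Re_has_derivative_vertical:
  assumes "(F has_field_derivative d) (at (Complex x t))"
  shows "((\<lambda>t. Re (F (Complex x t))) has_real_derivative Re (\<i> * d)) (at t)"
  using bounded_linear.has_vector_derivative[OF bounded_linear_Re has_vector_derivative_vertical[OF assms]]
  by (simp only: has_real_derivative_iff_has_vector_derivative)

lemma Re_has_derivative_horizontal:
  assumes "(F has_field_derivative d) (at (Complex t y))"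
  shows "((\<lambda>t. Re (F (Complex t y))) has_real_derivative Re d) (at t)"
  using bounded_linear.has_vector_derivative[OF bounded_linear_Re has_vector_derivative_horizontal[OF assms]]
  by (simp only: has_real_derivative_iff_has_vector_derivative)

text \<open>The function \<open>exp (F/M)\<close> is bounded by \<open>e\<close>, and from below by \<open>1/e\<close>, as soon as the real part of
  \<open>F\<close> is bounded by \<open>M\<close>. Cauchy's estimate for the exponential therefore bounds \<open>F'\<close> without
  information on the imaginary part.\<close>

lemma deriv_bound_by_Re:
  assumes F: "F holomorphic_on ball z r" and r: "r > 0" and M: "M > 0"
    and bd: "\<And>w. w \<in> ball z r \<Longrightarrow> \<bar>Re (F w)\<bar> \<le> M"
  shows "cmod (deriv F z) \<le> 4 * exp 2 * M / r"
proof -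
  define f where "f = (\<lambda>w. exp (F w / of_real M))"
  have fF: "cmod (f w) = exp (Re (F w) / M)" for w
    by (simp add: f_def)
  have hf: "f holomorphic_on ball z r"
    unfolding f_def using F M by (intro holomorphic_intros) auto
  have sub: "cball z (r/2) \<subseteq> ball z r" using r by auto
  have "cmod ((deriv ^^ 1) f z) \<le> fact 1 * (2 * exp 1) / (r/2) ^ 1"
  proof (rule Cauchy_higher_deriv_bound)
    show "f holomorphic_on ball z (r/2)"
      using r by (intro holomorphic_on_subset[OF hf] subset_ball) simp
    show "continuous_on (cball z (r/2)) f"
      using holomorphic_on_imp_continuous_on[OF hf] sub continuous_on_subset by blast
    fix w assume "w \<in> ball z (r/2)"
    then have "w \<in> ball z r" using sub ball_subset_cball by blast
    then have "Re (F w) / M \<le> 1" using bd[of w] M by (simp add: divide_le_eq)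
    then have "exp (Re (F w) / M) \<le> exp 1" by simp
    also have "\<dots> < 2 * exp 1" by simp
    finally show "f w \<in> ball 0 (2 * exp 1)" using fF[of w] by simp
  qed (use r in auto)
  then have b1: "cmod (deriv f z) \<le> 4 * exp 1 / r" by simp
  have "(F has_field_derivative deriv F z) (at z)"
    using F r by (intro holomorphic_derivI[of F "ball z r"]) auto
  then have "(f has_field_derivative f z * (deriv F z / of_real M)) (at z)"
    unfolding f_def using M by (auto intro!: derivative_eq_intros)
  then have "deriv f z = f z * (deriv F z / of_real M)" by (rule DERIV_imp_deriv)
  then have b2: "exp (Re (F z) / M) * (cmod (deriv F z) / M) \<le> 4 * exp 1 / r"
    using b1 M by (simp add: norm_mult norm_divide fF)
  have "- 1 \<le> Re (F z) / M" using bd[of z] r M by (simp add: field_simps)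
  then have "exp (-1) \<le> exp (Re (F z) / M)" by simp
  then have "exp (-1) * (cmod (deriv F z) / M) \<le> exp (Re (F z) / M) * (cmod (deriv F z) / M)"
    using M by (intro mult_right_mono) auto
  also note b2
  finally have "exp (-1) * (cmod (deriv F z) / M) \<le> 4 * exp 1 / r" .
  then have "exp 1 * (exp (-1) * (cmod (deriv F z) / M)) \<le> exp 1 * (4 * exp 1 / r)"
    by (rule mult_left_mono) simp
  moreover have "exp 1 * (exp (-1) * (cmod (deriv F z) / M)) = cmod (deriv F z) / M"
    by (simp add: exp_minus)
  moreover have "exp 1 * (4 * exp 1 / r) = 4 * exp (2::real) / r"
    using exp_add[of "1::real" 1] by simp
  ultimately have "cmod (deriv F z) / M \<le> 4 * exp 2 / r" by (simp only:)
  then have "cmod (deriv F z) \<le> 4 * exp 2 / r * M"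
    using M by (simp only: pos_divide_le_eq)
  then show ?thesis by simp
qed

lemma mult_ln_le_sqrt:
  fixes \<sigma> t :: real
  assumes "\<sigma> > 0" "t > 0"
  shows "t * (ln \<sigma> - ln t) \<le> 2 * (sqrt \<sigma> * sqrt t)"
proof -
  have "ln \<sigma> - ln t = 2 * ln (sqrt (\<sigma> / t))"
    using assms by (simp add: ln_sqrt ln_div)
  also have "\<dots> \<le> 2 * sqrt (\<sigma> / t)"
    using assms ln_bound[of "sqrt (\<sigma> / t)"] by simp
  finally have "t * (ln \<sigma> - ln t) \<le> t * (2 * sqrt (\<sigma> / t))"
    using assms by (intro mult_left_mono) auto
  also have "\<dots> = 2 * (sqrt \<sigma> * sqrt t)"
    using assms by (simp add: real_sqrt_divide field_simps)
  finally show ?thesis .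
qed

lemma at_within_upper_half_plane_neq_bot:
  assumes "Im p = 0"
  shows "at p within {z. Im z > 0} \<noteq> bot"
proof -
  have "p islimpt {z. Im z > 0}"
    unfolding islimpt_approachable
  proof (intro allI impI)
    fix e :: real assume "e > 0"
    then show "\<exists>x'\<in>{z. 0 < Im z}. x' \<noteq> p \<and> dist x' p < e"
      using assms by (intro bexI[of _ "p + \<i> * of_real (e/2)"]) (auto simp: dist_norm norm_mult complex_eq_iff)
  qed
  then show ?thesis by (simp add: trivial_limit_within)
qed

text \<open>By \<open>deriv_bound_by_Re\<close> on the disc around \<open>z\<close> that touches the axis, \<open>F'\<close> is \<open>O(1/y)\<close>, so \<open>F\<close>
  is \<open>O(log 1/y)\<close>. A logarithm is integrable, so \<open>H\<close> is uniformly Cauchy along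
  vertical segments. Together with continuity of \<open>H\<close> at a fixed small height this is the Cauchy
  criterion at \<open>p\<close>.\<close>

lemma primitive_has_boundary_limit:
  assumes \<rho>: "\<rho> > 0" and p: "Im p = 0" and D: "D = ball p \<rho> \<inter> {z. Im z > 0}"
    and F: "F holomorphic_on D" and bd: "\<And>z. z \<in> D \<Longrightarrow> \<bar>Re (F z)\<bar> \<le> M"
    and H: "\<And>z. z \<in> D \<Longrightarrow> (H has_field_derivative F z) (at z)"
  shows "\<exists>l. (H \<longlongrightarrow> l) (at p within {z. Im z > 0})"
proof -
  define \<sigma> where "\<sigma> = \<rho> / 4"
  have \<sigma>: "\<sigma> > 0" using \<rho> by (simp add: \<sigma>_def)
  define M' where "M' = max M 1"
  have M': "M' > 0" "\<And>z. z \<in> D \<Longrightarrow> \<bar>Re (F z)\<bar> \<le> M'" using bd by (force simp: M'_def)+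
  define C where "C = 4 * exp 2 * M'"
  have C: "C > 0" using M' by (simp add: C_def)
  have openD: "open D" unfolding D by (intro open_Int open_halfspace_Im_gt) auto
  \<comment> \<open>The box of half-width \<open>\<sigma>\<close> around \<open>p\<close> lies in the ball with radius \<open>\<rho>/2\<close>, so the disc around a
    point of its upper half that touches the axis stays in \<open>D\<close>.\<close>
  have box: "dist p z \<le> \<rho>/2" if "\<bar>Re z - Re p\<bar> \<le> \<sigma>" "\<bar>Im z\<bar> \<le> \<sigma>" for z
  proof -
    have "cmod (z - p) \<le> \<bar>Re (z - p)\<bar> + \<bar>Im (z - p)\<bar>" by (rule cmod_le)
    also have "\<dots> \<le> \<sigma> + \<sigma>" using that p by simp
    finally have "cmod (z - p) \<le> \<rho>/2" by (simp add: \<sigma>_def)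
    then show ?thesis by (simp add: dist_norm norm_minus_commute)
  qed
  have inD: "z \<in> D" if "\<bar>Re z - Re p\<bar> \<le> \<sigma>" "0 < Im z" "Im z \<le> \<sigma>" for z
    using box[of z] that \<rho> by (auto simp: D)
  have dF: "cmod (deriv F z) \<le> C / Im z" if "\<bar>Re z - Re p\<bar> \<le> \<sigma>" "0 < Im z" "Im z \<le> \<sigma>" for z
  proof -
    have "ball z (Im z) \<subseteq> D"
    proof
      fix w assume w: "w \<in> ball z (Im z)"
      have "\<bar>Im (w - z)\<bar> \<le> cmod (w - z)" by (rule abs_Im_le_cmod)
      with w have "Im w > 0" by (simp add: dist_norm norm_minus_commute)
      moreover have "dist p w \<le> dist p z + dist z w" by (rule dist_triangle)
      then have "dist p w < \<rho>" using box[of z] w that \<rho> by (simp add: \<sigma>_def)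
      ultimately show "w \<in> D" by (simp add: D)
    qed
    then show ?thesis unfolding C_def
      using F M' that by (intro deriv_bound_by_Re) (auto intro: holomorphic_on_subset)
  qed
  have "compact (F ` cbox (Complex (Re p - \<sigma>) \<sigma>) (Complex (Re p + \<sigma>) \<sigma>))"
    using \<sigma> by (intro compact_continuous_image continuous_on_subset[OF holomorphic_on_imp_continuous_on[OF F]])
      (auto simp: in_cbox_complex_iff intro!: inD)
  then obtain N where N: "\<And>z. z \<in> cbox (Complex (Re p - \<sigma>) \<sigma>) (Complex (Re p + \<sigma>) \<sigma>) \<Longrightarrow> cmod (F z) \<le> N"
    by (meson bounded_iff compact_imp_bounded image_eqI)
  have N0: "0 \<le> N"
    using \<sigma> by (intro order_trans[OF norm_ge_zero N[of "Complex (Re p) \<sigma>"]]) (simp add: in_cbox_complex_iff)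
  have bF: "cmod (F (Complex x y)) \<le> N + C * (ln \<sigma> - ln y)" if "\<bar>x - Re p\<bar> \<le> \<sigma>" "0 < y" "y \<le> \<sigma>" for x y
  proof (cases "y = \<sigma>")
    case True
    then show ?thesis using N[of "Complex x y"] that by (simp add: in_cbox_complex_iff abs_le_iff)
  next
    case False
    have der: "((\<lambda>t. F (Complex x t)) has_vector_derivative \<i> * deriv F (Complex x t)) (at t)"
      if "y \<le> t" "t \<le> \<sigma>" for t
      using that \<open>\<bar>x - Re p\<bar> \<le> \<sigma>\<close> \<open>0 < y\<close>
      by (intro has_vector_derivative_vertical holomorphic_derivI[OF F openD] inD) auto
    have "norm (F (Complex x \<sigma>) - F (Complex x y)) \<le> C * ln \<sigma> - C * ln y"
    proof (rule differentiable_bound_general)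
      show "y < \<sigma>" using that False by simp
      show "continuous_on {y..\<sigma>} (\<lambda>t. F (Complex x t))"
        by (intro continuous_at_imp_continuous_on ballI has_vector_derivative_continuous[OF der]) auto
      show "continuous_on {y..\<sigma>} (\<lambda>t. C * ln t)"
        using that by (intro continuous_intros) auto
      fix t assume t: "y < t" "t < \<sigma>"
      then show "((\<lambda>t. F (Complex x t)) has_vector_derivative \<i> * deriv F (Complex x t)) (at t)"
        by (intro der) auto
      have "((\<lambda>t. C * ln t) has_real_derivative C / t) (at t)"
        using t that by (auto intro!: derivative_eq_intros)
      then show "((\<lambda>t. C * ln t) has_vector_derivative C / t) (at t)"
        by (simp add: has_real_derivative_iff_has_vector_derivative)
      show "norm (\<i> * deriv F (Complex x t)) \<le> C / t"
        using dF[of "Complex x t"] t that by (simp add: norm_mult)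
    qed
    moreover have "cmod (F (Complex x \<sigma>)) \<le> N"
      using N[of "Complex x \<sigma>"] that by (simp add: in_cbox_complex_iff abs_le_iff)
    ultimately show ?thesis
      using norm_triangle_ineq2[of "F (Complex x y)" "F (Complex x \<sigma>)"]
      by (simp add: norm_minus_commute right_diff_distrib)
  qed
  \<comment> \<open>A primitive of the bound \<open>N + C ln (\<sigma>/t)\<close> for \<open>F\<close> that tends to \<open>0\<close> with \<open>t\<close>.\<close>
  define \<phi> where "\<phi> = (\<lambda>t. N * t + C * (t * (ln \<sigma> - ln t) + t))"
  have \<phi>0: "\<phi> t \<ge> 0" if "0 < t" "t \<le> \<sigma>" for t
    using that N0 C by (auto simp: \<phi>_def intro!: add_nonneg_nonneg mult_nonneg_nonneg)
  have bH: "cmod (H (Complex x y2) - H (Complex x y1)) \<le> \<phi> y2"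
    if "\<bar>x - Re p\<bar> \<le> \<sigma>" "0 < y1" "y1 < y2" "y2 \<le> \<sigma>" for x y1 y2
  proof -
    have der: "((\<lambda>t. H (Complex x t)) has_vector_derivative \<i> * F (Complex x t)) (at t)"
      if "y1 \<le> t" "t \<le> y2" for t
      using that \<open>\<bar>x - Re p\<bar> \<le> \<sigma>\<close> \<open>0 < y1\<close> \<open>y2 \<le> \<sigma>\<close>
      by (intro has_vector_derivative_vertical H inD) auto
    have "norm (H (Complex x y2) - H (Complex x y1)) \<le> \<phi> y2 - \<phi> y1"
    proof (rule differentiable_bound_general)
      show "y1 < y2" by fact
      show "continuous_on {y1..y2} (\<lambda>t. H (Complex x t))"
        by (intro continuous_at_imp_continuous_on ballI has_vector_derivative_continuous[OF der]) auto
      show "continuous_on {y1..y2} \<phi>"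
        unfolding \<phi>_def using that by (intro continuous_intros) auto
      fix t assume t: "y1 < t" "t < y2"
      then show "((\<lambda>t. H (Complex x t)) has_vector_derivative \<i> * F (Complex x t)) (at t)"
        by (intro der) auto
      have "(\<phi> has_real_derivative N + C * (ln \<sigma> - ln t)) (at t)"
        unfolding \<phi>_def using t that by (auto intro!: derivative_eq_intros simp: algebra_simps)
      then show "(\<phi> has_vector_derivative N + C * (ln \<sigma> - ln t)) (at t)"
        by (simp add: has_real_derivative_iff_has_vector_derivative)
      show "norm (\<i> * F (Complex x t)) \<le> N + C * (ln \<sigma> - ln t)"
        using bF[of x t] t that by (simp add: norm_mult)
    qed
    then show ?thesis using \<phi>0[of y1] that by simp
  qed
  have \<phi>le: "\<phi> t \<le> (N + C) * t + 2 * C * (sqrt \<sigma> * sqrt t)" if "0 < t" for t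
  proof -
    have "C * (t * (ln \<sigma> - ln t)) \<le> C * (2 * (sqrt \<sigma> * sqrt t))"
      using C mult_ln_le_sqrt[OF \<sigma> that] by (intro mult_left_mono) auto
    then show ?thesis by (simp add: \<phi>_def algebra_simps)
  qed
  define Fl where "Fl = at p within {z. Im z > 0}"
  have nt: "Fl \<noteq> bot"
    using at_within_upper_half_plane_neq_bot[OF p] by (simp add: Fl_def)
  have "cauchy_filter (filtermap H Fl)"
    unfolding cauchy_filter_metric_filtermap
  proof (intro allI impI)
    fix e :: real assume e: "e > 0"
    have "((\<lambda>t. (N + C) * t + 2 * C * (sqrt \<sigma> * sqrt t)) \<longlongrightarrow> (N + C) * 0 + 2 * C * (sqrt \<sigma> * sqrt 0)) (at_right 0)"
      by (intro tendsto_intros)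
    then have "eventually (\<lambda>t. (N + C) * t + 2 * C * (sqrt \<sigma> * sqrt t) < e/3) (at_right 0)"
      using e by (intro order_tendstoD(2)[where y = 0]) auto
    moreover have "eventually (\<lambda>t. t < \<sigma> \<and> 0 < t) (at_right (0::real))"
      using eventually_at_right_real[OF \<sigma>] by (simp add: conj_commute)
    ultimately have "eventually (\<lambda>t. (N + C) * t + 2 * C * (sqrt \<sigma> * sqrt t) < e/3 \<and> t < \<sigma> \<and> 0 < t) (at_right 0)"
      by eventually_elim auto
    then obtain \<eta> where \<eta>: "(N + C) * \<eta> + 2 * C * (sqrt \<sigma> * sqrt \<eta>) < e/3" "\<eta> < \<sigma>" "0 < \<eta>"
      by (metis (no_types, lifting) eventually_happens trivial_limit_at_right_real)
    have \<phi>\<eta>: "\<phi> \<eta> < e/3" using \<phi>le[of \<eta>] \<eta> by linarith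
    define c where "c = Complex (Re p) \<eta>"
    have "c \<in> D" using \<eta> \<sigma> by (intro inD) (auto simp: c_def)
    then have "isCont H c" using H DERIV_isCont by blast
    then obtain \<tau> where \<tau>: "\<tau> > 0" "\<And>w. dist w c < \<tau> \<Longrightarrow> dist (H w) (H c) < e/6"
      using e unfolding continuous_at_eps_delta by (metis divide_pos_pos zero_less_numeral)
    define P where "P = (\<lambda>z. Im z > 0 \<and> dist z p < min \<tau> \<eta>)"
    have "eventually P Fl"
      using \<tau> \<eta> unfolding Fl_def eventually_at P_def by (intro exI[of _ "min \<tau> \<eta>"]) auto
    moreover have near: "dist (H z) (H c) < e/2" if "P z" for z
    proof -
      have z: "Im z > 0" "cmod (z - p) < \<tau>" "cmod (z - p) < \<eta>"
        using that by (auto simp: P_def dist_norm)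
      have i: "Im z < \<eta>" using abs_Im_le_cmod[of "z - p"] z p by simp
      have r: "\<bar>Re z - Re p\<bar> < \<tau>" "\<bar>Re z - Re p\<bar> \<le> \<sigma>" using abs_Re_le_cmod[of "z - p"] z \<eta> by auto
      have "cmod (H (Complex (Re z) \<eta>) - H (Complex (Re z) (Im z))) \<le> \<phi> \<eta>"
        using r i z \<eta> by (intro bH) auto
      moreover have "dist (Complex (Re z) \<eta>) c < \<tau>"
        using r by (simp add: c_def dist_norm cmod_def)
      then have "dist (H (Complex (Re z) \<eta>)) (H c) < e/6" by (rule \<tau>)
      moreover have "dist (H z) (H c) \<le> dist (H z) (H (Complex (Re z) \<eta>)) + dist (H (Complex (Re z) \<eta>)) (H c)"
        by (rule dist_triangle)
      ultimately show ?thesis using \<phi>\<eta> by (simp add: dist_norm norm_minus_commute)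
    qed
    moreover have "dist (H z) (H w) < e" if "P z" "P w" for z w
      using near[OF that(1)] near[OF that(2)] dist_triangle2[of "H z" "H w" "H c"] by linarith
    ultimately show "\<exists>P. eventually P Fl \<and> (\<forall>x y. P x \<and> P y \<longrightarrow> dist (H x) (H y) < e)"
      by blast
  qed
  then have "\<exists>c. filtermap H Fl \<le> nhds c"
    using nt by (intro cauchy_filter_complete_converges[of _ UNIV]) (auto simp: complete_UNIV filtermap_bot_iff)
  then show ?thesis by (simp add: Fl_def filterlim_def)
qed

definition upper_part :: "complex set \<Rightarrow> complex set" where
  "upper_part S = S \<inter> {z. Im z > 0}"

lemma open_upper_part: "open S \<Longrightarrow> open (upper_part S)"
  unfolding upper_part_def by (intro open_Int open_halfspace_Im_gt)

lemma convex_upper_part: "convex S \<Longrightarrow> convex (upper_part S)"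
  unfolding upper_part_def by (intro convex_Int convex_halfspace_Im_gt)

lemma at_within_upper_part:
  assumes "open S" "p \<in> S"
  shows "at p within upper_part S = at p within {z. Im z > 0}"
  by (rule at_within_nhd[OF assms(2,1)]) (auto simp: upper_part_def)

lemma filterlim_vertical_approach:
  "filterlim (Complex x) (at (of_real x) within {z. Im z > 0}) (at_right 0)"
  unfolding filterlim_at
proof
  show "eventually (\<lambda>t. Complex x t \<in> {z. Im z > 0} \<and> Complex x t \<noteq> of_real x) (at_right 0)"
    using eventually_at_right_less[of "0::real"] by eventually_elim (auto simp: complex_eq_iff)
  have eq: "Complex x = (\<lambda>t. of_real x + \<i> * of_real t)"
    by (simp add: fun_eq_iff complex_eq_iff)
  have "((\<lambda>t. of_real x + \<i> * of_real t) \<longlongrightarrow> of_real x + \<i> * of_real 0) (at_right 0)"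
    by (intro tendsto_intros)
  then show "(Complex x \<longlongrightarrow> of_real x) (at_right 0)" unfolding eq by simp
qed

lemma deriv_cnj_symmetric:
  assumes S: "open S" "cnj ` S \<subseteq> S" and f: "f holomorphic_on S"
    and sym: "\<And>z. z \<in> S \<Longrightarrow> f (cnj z) = of_real c * cnj (f z)" and z: "z \<in> S"
  shows "deriv f (cnj z) = of_real c * cnj (deriv f z)"
proof -
  have cz: "cnj z \<in> S" using S(2) z by auto
  have "(f has_field_derivative deriv f z) (at z)"
    using holomorphic_derivI[OF f S(1) z] .
  then have "(cnj \<circ> f \<circ> cnj has_field_derivative cnj (deriv f z)) (at (cnj z))"
    using has_field_derivative_cnj_cnj[of f "deriv f z" "cnj z"] by simp
  then have "((\<lambda>w. of_real c * (cnj \<circ> f \<circ> cnj) w) has_field_derivative of_real c * cnj (deriv f z)) (at (cnj z))"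
    by (rule DERIV_cmult)
  then have "(f has_field_derivative of_real c * cnj (deriv f z)) (at (cnj z))"
  proof (rule has_field_derivative_transform_within_open[OF _ S(1) cz])
    fix w assume "w \<in> S"
    then have "cnj w \<in> S" using S(2) by auto
    from sym[OF this] show "of_real c * (cnj \<circ> f \<circ> cnj) w = f w" by simp
  qed
  then show ?thesis by (rule DERIV_imp_deriv)
qed

text \<open>The classical principle asks for continuity up to the axis, which is not known for \<open>F\<close> but holds
  for a primitive \<open>H\<close>. The boundary values of \<open>Re H\<close> are constant, since along horizontal
  lines its derivative is \<open>Re F\<close>, which tends to \<open>0\<close> locally uniformly. Reflect
  \<open>\<i>(H - c)\<close>, which is real on the axis, and differentiate.\<close>

lemma strong_Schwarz_reflection:
  assumes S: "open S" "convex S" "cnj ` S \<subseteq> S"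
    and F: "F holomorphic_on upper_part S"
    and lim: "\<And>p. p \<in> S \<Longrightarrow> Im p = 0 \<Longrightarrow> ((\<lambda>z. Re (F z)) \<longlongrightarrow> 0) (at p within upper_part S)"
  obtains G where "G holomorphic_on S" "\<And>z. z \<in> upper_part S \<Longrightarrow> G z = F z"
    "\<And>z. z \<in> S \<Longrightarrow> G (cnj z) = - cnj (G z)"
proof -
  define Up where "Up = {z. Im z > 0}"
  have lim': "((\<lambda>z. Re (F z)) \<longlongrightarrow> 0) (at p within Up)" if "p \<in> S" "Im p = 0" for p
    using lim[OF that] at_within_upper_part[OF S(1) that(1)] by (simp add: Up_def)
  have nt: "at p within Up \<noteq> bot" if "Im p = 0" for p
    using at_within_upper_half_plane_neq_bot[OF that] by (simp add: Up_def)
  obtain H where H: "H holomorphic_on upper_part S" "\<And>z. z \<in> upper_part S \<Longrightarrow> (H has_field_derivative F z) (at z)"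
    using holomorphic_primitive[OF F convex_upper_part[OF S(2)] open_upper_part[OF S(1)]] by blast
  have small: "\<exists>\<rho>>0. ball p \<rho> \<subseteq> S \<and> (\<forall>z \<in> ball p \<rho> \<inter> Up. \<bar>Re (F z)\<bar> \<le> e)"
    if p: "p \<in> S" "Im p = 0" and e: "e > 0" for p e
  proof -
    obtain r where r: "r > 0" "ball p r \<subseteq> S" using S(1) p open_contains_ball by blast
    have "eventually (\<lambda>z. \<bar>Re (F z)\<bar> < e) (at p within Up)"
      using tendstoD[OF lim'[OF p] e] by simp
    then obtain d where d: "d > 0" "\<And>z. z \<in> Up \<Longrightarrow> z \<noteq> p \<Longrightarrow> dist z p < d \<Longrightarrow> \<bar>Re (F z)\<bar> < e"
      unfolding eventually_at by blast
    have "\<bar>Re (F z)\<bar> \<le> e" if "z \<in> ball p (min r d) \<inter> Up" for z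
    proof -
      have "z \<noteq> p" using that p by (auto simp: Up_def)
      then show ?thesis using that d(2)[of z] by (simp add: dist_commute)
    qed
    moreover have "ball p (min r d) \<subseteq> S" using r by auto
    ultimately show ?thesis using r d by (intro exI[of _ "min r d"]) auto
  qed
  define L where "L = (\<lambda>p. Lim (at p within Up) H)"
  have L: "(H \<longlongrightarrow> L p) (at p within Up)" if p: "p \<in> S" "Im p = 0" for p
  proof -
    obtain \<rho> where \<rho>: "\<rho> > 0" "ball p \<rho> \<subseteq> S" "\<forall>z \<in> ball p \<rho> \<inter> Up. \<bar>Re (F z)\<bar> \<le> 1"
      using small[OF p, of 1] by auto
    have sub: "ball p \<rho> \<inter> Up \<subseteq> upper_part S" using \<rho>(2) by (auto simp: upper_part_def Up_def)
    have "\<exists>l. (H \<longlongrightarrow> l) (at p within {z. Im z > 0})"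
      by (rule primitive_has_boundary_limit[OF \<rho>(1) p(2) refl, of F 1])
        (use sub \<rho> H F in \<open>auto simp: Up_def intro: holomorphic_on_subset\<close>)
    then show ?thesis
      using tendsto_Lim[OF nt[OF p(2)]] unfolding L_def Up_def by blast
  qed
  define Hb where "Hb = (\<lambda>z. if Im z > 0 then H z else L z)"
  have contHb: "continuous_on (S \<inter> {z. 0 \<le> Im z}) Hb"
    unfolding continuous_on_eq_continuous_within
  proof
    fix p assume p: "p \<in> S \<inter> {z. 0 \<le> Im z}"
    show "continuous (at p within S \<inter> {z. 0 \<le> Im z}) Hb"
    proof (cases "Im p > 0")
      case True
      then have pu: "p \<in> upper_part S" using p by (auto simp: upper_part_def)
      then have "isCont H p" using H(2) DERIV_isCont by blast
      moreover have "eventually (\<lambda>z. z \<in> upper_part S) (nhds p)"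
        using open_upper_part[OF S(1)] pu eventually_nhds by blast
      then have "eventually (\<lambda>z. Hb z = H z) (nhds p)"
        by eventually_elim (auto simp: Hb_def upper_part_def)
      ultimately have "isCont Hb p" using isCont_cong by blast
      then show ?thesis by (rule continuous_at_imp_continuous_at_within)
    next
      case False
      with p have p: "p \<in> S" "Im p = 0" by auto
      show ?thesis
        unfolding continuous_within_eps_delta
      proof (intro allI impI)
        fix e :: real assume e: "e > 0"
        have "eventually (\<lambda>z. dist (H z) (L p) < e/2) (at p within Up)"
          using tendstoD[OF L[OF p], of "e/2"] e by simp
        then obtain d where d: "d > 0" "\<And>z. z \<in> Up \<Longrightarrow> z \<noteq> p \<Longrightarrow> dist z p < d \<Longrightarrow> dist (H z) (L p) < e/2"
          unfolding eventually_at by blast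
        have "dist (Hb q) (Hb p) < e" if q: "q \<in> S" "0 \<le> Im q" "dist q p < d" for q
        proof (cases "Im q > 0")
          case True
          then have "dist (H q) (L p) < e/2" using q p by (intro d) (auto simp: Up_def)
          then show ?thesis using True p e by (simp add: Hb_def)
        next
          case False
          with q have q: "q \<in> S" "Im q = 0" "dist q p < d" by auto
          have "eventually (\<lambda>z. z \<in> ball p d) (at q within Up)"
            using q by (intro topological_tendstoD[OF tendsto_ident_at]) (auto simp: dist_commute)
          moreover have "eventually (\<lambda>z. z \<in> Up) (at q within Up)"
            by (simp add: eventually_at_filter)
          ultimately have "eventually (\<lambda>z. dist (H z) (L p) \<le> e/2) (at q within Up)"
          proof eventually_elim
            case (elim z)
            then have "z \<noteq> p" using p by (auto simp: Up_def)
            then show ?case using elim d(2)[of z] by (simp add: dist_commute)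
          qed
          moreover have "((\<lambda>z. dist (H z) (L p)) \<longlongrightarrow> dist (L q) (L p)) (at q within Up)"
            by (intro tendsto_intros L q)
          ultimately have "dist (L q) (L p) \<le> e/2"
            using nt[OF q(2)] tendsto_upperbound by blast
          then show ?thesis using q p e by (simp add: Hb_def)
        qed
        then show "\<exists>d>0. \<forall>x'\<in>S \<inter> {z. 0 \<le> Im z}. dist x' p < d \<longrightarrow> dist (Hb x') (Hb p) < e"
          using d(1) by auto
      qed
    qed
  qed
  define X where "X = {x. complex_of_real x \<in> S}"
  have X: "convex X"
  proof -
    have "X = of_real -` S" by (auto simp: X_def)
    moreover have "linear complex_of_real" by (simp add: bounded_linear.linear bounded_linear_of_real)
    ultimately show ?thesis using S(2) convex_linear_vimage by metis
  qed
  have limV: "((\<lambda>t. H (Complex x t)) \<longlongrightarrow> L (of_real x)) (at_right 0)" if "x \<in> X" for x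
    using filterlim_compose[OF L[of "of_real x"] filterlim_vertical_approach[of x, folded Up_def]] that
    by (simp add: X_def)
  have "\<exists>c. \<forall>x\<in>X. Re (L (of_real x)) = c"
  proof (rule has_derivative_zero_constant[OF X])
    fix x assume x: "x \<in> X"
    show "((\<lambda>x. Re (L (of_real x))) has_derivative (\<lambda>h. 0)) (at x within X)"
      unfolding has_derivative_within_alt
    proof (intro conjI allI impI)
      show "bounded_linear (\<lambda>h::real. 0::real)" by (rule bounded_linear_zero)
      fix e :: real assume e: "e > 0"
      obtain \<rho> where \<rho>: "\<rho> > 0" "ball (of_real x) \<rho> \<subseteq> S" "\<forall>z \<in> ball (of_real x) \<rho> \<inter> Up. \<bar>Re (F z)\<bar> \<le> e"
        using small[of "of_real x" e] x e by (auto simp: X_def)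
      have "\<bar>Re (L (of_real y)) - Re (L (of_real x))\<bar> \<le> e * \<bar>y - x\<bar>" if y: "y \<in> X" "\<bar>y - x\<bar> < \<rho>/2" for y
      proof -
        have "eventually (\<lambda>t. 0 < t \<and> t < \<rho>/2) (at_right (0::real))"
          using eventually_at_right_real[of 0 "\<rho>/2"] \<rho>(1) by simp
        then have le: "eventually (\<lambda>t. \<bar>Re (H (Complex y t)) - Re (H (Complex x t))\<bar> \<le> e * \<bar>y - x\<bar>) (at_right (0::real))"
        proof eventually_elim
          case (elim t)
          have inb: "Complex s t \<in> ball (of_real x) \<rho> \<inter> Up" if "s \<in> ball x (\<rho>/2)" for s
          proof -
            have "dist (of_real x) (Complex s t) \<le> \<bar>x - s\<bar> + \<bar>t\<bar>"
              using cmod_le[of "of_real x - Complex s t"] by (simp add: dist_norm)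
            then show ?thesis using that elim by (simp add: Up_def dist_real_def)
          qed
          have "norm (Re (H (Complex y t)) - Re (H (Complex x t))) \<le> e * norm (y - x)"
          proof (rule field_differentiable_bound[of "ball x (\<rho>/2)"])
            fix s assume s: "s \<in> ball x (\<rho>/2)"
            have "Complex s t \<in> upper_part S" using inb[OF s] \<rho>(2) by (auto simp: upper_part_def Up_def)
            then show "((\<lambda>s. Re (H (Complex s t))) has_real_derivative Re (F (Complex s t))) (at s within ball x (\<rho>/2))"
              by (rule has_field_derivative_at_within[OF Re_has_derivative_horizontal[OF H(2)]])
            show "norm (Re (F (Complex s t))) \<le> e" using \<rho>(3) inb[OF s] by auto
          qed (use y \<rho> in \<open>auto simp: dist_real_def abs_minus_commute\<close>)
          then show ?case by simp
        qed
        have lim: "((\<lambda>t. \<bar>Re (H (Complex y t)) - Re (H (Complex x t))\<bar>) \<longlongrightarrow>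
            \<bar>Re (L (of_real y)) - Re (L (of_real x))\<bar>) (at_right (0::real))"
          by (intro tendsto_intros limV x y)
        show ?thesis
          by (rule tendsto_upperbound[OF lim le]) simp
      qed
      then show "\<exists>d>0. \<forall>y\<in>X. norm (y - x) < d \<longrightarrow>
          norm (Re (L (of_real y)) - Re (L (of_real x)) - 0) \<le> e * norm (y - x)"
        using \<rho>(1) by (intro exI[of _ "\<rho>/2"]) auto
    qed
  qed
  then obtain c where c: "\<And>x. x \<in> X \<Longrightarrow> Re (L (of_real x)) = c" by blast
  define K where "K = (\<lambda>z. \<i> * (Hb z - of_real c))"
  define K' where "K' = (\<lambda>z. if 0 \<le> Im z then K z else cnj (K (cnj z)))"
  have Kreal: "K z \<in> \<real>" if "z \<in> S" "z \<in> \<real>" for z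
  proof -
    obtain x where x: "z = of_real x" using \<open>z \<in> \<real>\<close> by (auto elim: Reals_cases)
    then have "Re (L z) = c" using c[of x] that by (simp add: X_def)
    then show ?thesis by (simp add: K_def Hb_def x complex_is_Real_iff)
  qed
  have K': "K' holomorphic_on S"
    unfolding K'_def
  proof (rule Schwarz_reflection[OF S(1) S(3)])
    have "(\<lambda>z. \<i> * (H z - of_real c)) holomorphic_on upper_part S"
      using H(1) by (intro holomorphic_intros)
    then show "K holomorphic_on (S \<inter> {z. 0 < Im z})"
      unfolding upper_part_def by (rule holomorphic_transform) (auto simp: K_def Hb_def)
    show "continuous_on (S \<inter> {z. 0 \<le> Im z}) K"
      unfolding K_def by (intro continuous_intros contHb)
  qed (rule Kreal)
  have K'_cnj: "K' (cnj z) = cnj (K' z)" if "z \<in> S" for z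
  proof (cases "Im z = 0")
    case True
    then have "z \<in> \<real>" by (simp add: complex_is_Real_iff)
    then have "cnj (K z) = K z" "cnj z = z" using Kreal that Reals_cnj_iff by auto
    then show ?thesis using True by (simp add: K'_def)
  next
    case False
    then show ?thesis by (auto simp: K'_def)
  qed
  show ?thesis
  proof (rule that[of "\<lambda>z. - \<i> * deriv K' z"])
    show "(\<lambda>z. - \<i> * deriv K' z) holomorphic_on S"
      using K' S(1) by (intro holomorphic_intros holomorphic_deriv)
  next
    fix z assume z: "z \<in> upper_part S"
    have "((\<lambda>z. \<i> * (H z - of_real c)) has_field_derivative \<i> * F z) (at z)"
      using H(2)[OF z] by (auto intro!: derivative_eq_intros)
    then have "(K' has_field_derivative \<i> * F z) (at z)"
      by (rule has_field_derivative_transform_within_open[OF _ open_upper_part[OF S(1)] z])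
        (auto simp: K'_def K_def Hb_def upper_part_def)
    then have "deriv K' z = \<i> * F z" by (rule DERIV_imp_deriv)
    then show "- \<i> * deriv K' z = F z" by simp
  next
    fix z assume z: "z \<in> S"
    have "deriv K' (cnj z) = cnj (deriv K' z)"
      using deriv_cnj_symmetric[OF S(1,3) K', of 1 z] K'_cnj z by simp
    then show "- \<i> * deriv K' (cnj z) = - cnj (- \<i> * deriv K' z)" by simp
  qed
qed

lemma extension_of_primitive:
  assumes S: "open S" "convex S"
    and f: "f holomorphic_on upper_part S" and g: "g holomorphic_on S"
    and eq: "\<And>z. z \<in> upper_part S \<Longrightarrow> deriv f z = g z"
  obtains h where "h holomorphic_on S" "\<And>z. z \<in> upper_part S \<Longrightarrow> h z = f z"
    "\<And>z. z \<in> S \<Longrightarrow> (h has_field_derivative g z) (at z)"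
proof -
  obtain G where G: "G holomorphic_on S" "\<And>z. z \<in> S \<Longrightarrow> (G has_field_derivative g z) (at z)"
    using holomorphic_primitive[OF g S(2,1)] by blast
  have "\<exists>c. \<forall>z\<in>upper_part S. f z - G z = c"
  proof (rule has_field_derivative_zero_constant[OF convex_upper_part[OF S(2)]])
    fix z assume z: "z \<in> upper_part S"
    have "(f has_field_derivative g z) (at z)"
      using holomorphic_derivI[OF f open_upper_part[OF S(1)] z] eq[OF z] by simp
    moreover have "(G has_field_derivative g z) (at z)" using z by (intro G) (auto simp: upper_part_def)
    ultimately have "((\<lambda>z. f z - G z) has_field_derivative g z - g z) (at z)"
      by (rule DERIV_diff)
    then show "((\<lambda>z. f z - G z) has_field_derivative 0) (at z within upper_part S)"
      by (simp add: has_field_derivative_at_within)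
  qed
  then obtain c where c: "\<And>z. z \<in> upper_part S \<Longrightarrow> f z - G z = c" by blast
  show ?thesis
  proof (rule that[of "\<lambda>z. G z + c"])
    show "(\<lambda>z. G z + c) holomorphic_on S" using G(1) by (intro holomorphic_intros)
    show "G z + c = f z" if "z \<in> upper_part S" for z using c[OF that] by (simp add: algebra_simps)
    show "((\<lambda>z. G z + c) has_field_derivative g z) (at z)" if "z \<in> S" for z
      using G(2)[OF that] by (auto intro!: derivative_eq_intros)
  qed
qed

section \<open>Boundary behaviour on mirror-symmetric domains\<close>

text \<open>Pizzetti's formula: the mean of \<open>u = Re A + y Re B\<close> over a circle with radius \<open>s\<close> exceeds
  \<open>u(z0)\<close> by \<open>s\<^sup>2 \<Delta>u(z0)/4\<close>. To see it, put \<open>w = z - z0\<close>; on the circle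
  \<open>y = Im z0 + (w - s\<^sup>2/w)/(2\<i>)\<close>, which makes \<open>A + y B\<close> meromorphic with its only pole at
  \<open>z0\<close>, and Cauchy's formula computes its mean.\<close>

lemma Pizzetti_bound:
  assumes A: "A holomorphic_on ball z0 r" and B: "B holomorphic_on ball z0 r" and r: "r > 0"
    and bd: "\<And>z. z \<in> ball z0 r \<Longrightarrow> \<bar>Re (A z) + Im z * Re (B z)\<bar> \<le> K"
  shows "\<bar>Re (\<i> * deriv B z0)\<bar> \<le> 16 * K / r\<^sup>2"
proof -
  define s where "s = r / 2"
  have s: "s > 0" "s < r" using r by (auto simp: s_def)
  define f where "f = (\<lambda>u. A u + of_real (Im z0) * B u + (u - z0) / (2 * \<i>) * B u)"
  have sub: "cball z0 s \<subseteq> ball z0 r" using s by auto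
  have f: "f holomorphic_on ball z0 r"
    unfolding f_def using A B by (intro holomorphic_intros) auto
  have cont: "continuous_on (cball z0 s) g" "g holomorphic_on ball z0 s" if "g holomorphic_on ball z0 r" for g
    using holomorphic_on_subset[OF that] sub ball_subset_cball
    by (blast intro: holomorphic_on_imp_continuous_on)+
  define V where "V = f z0 - of_real s ^ 2 / (2 * \<i>) * deriv B z0"
  define \<Phi> where "\<Phi> = (\<lambda>u. f u - of_real s ^ 2 / (2 * \<i>) * (B u / (u - z0)))"
  have 1: "((\<lambda>u. f u / (u - z0)) has_contour_integral (2 * of_real pi * \<i> * f z0)) (circlepath z0 s)"
    using cont[OF f] s by (intro Cauchy_integral_circlepath) auto
  have 2: "((\<lambda>u. B u / (u - z0) ^ Suc 1) has_contour_integral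
      (2 * pi * \<i> / fact 1) * (deriv ^^ 1) B z0) (circlepath z0 s)"
    using cont[OF B] s by (intro Cauchy_has_contour_integral_higher_derivative_circlepath) auto
  have "((\<lambda>u. f u / (u - z0) - of_real s ^ 2 / (2 * \<i>) * (B u / (u - z0) ^ Suc 1)) has_contour_integral
      (2 * of_real pi * \<i> * f z0 - of_real s ^ 2 / (2 * \<i>) * ((2 * pi * \<i> / fact 1) * (deriv ^^ 1) B z0))) (circlepath z0 s)"
    by (intro has_contour_integral_diff has_contour_integral_lmul 1 2)
  moreover have "2 * of_real pi * \<i> * f z0 - of_real s ^ 2 / (2 * \<i>) * ((2 * pi * \<i> / fact 1) * (deriv ^^ 1) B z0)
      = 2 * of_real pi * \<i> * V"
    by (simp add: V_def algebra_simps)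
  moreover have "(\<lambda>u. f u / (u - z0) - of_real s ^ 2 / (2 * \<i>) * (B u / (u - z0) ^ Suc 1)) = (\<lambda>u. \<Phi> u / (u - z0))"
  proof
    have "a / d - c * (b / d ^ Suc 1) = (a - c * (b / d)) / d" for a b c d :: complex
      by (simp add: diff_divide_distrib)
    then show "f u / (u - z0) - of_real s ^ 2 / (2 * \<i>) * (B u / (u - z0) ^ Suc 1) = \<Phi> u / (u - z0)" for u
      unfolding \<Phi>_def .
  qed
  ultimately have "((\<lambda>u. \<Phi> u / (u - z0)) has_contour_integral 2 * of_real pi * \<i> * V) (circlepath z0 s)"
    by simp
  then have "((\<lambda>x. \<Phi> (circlepath z0 s x) / (circlepath z0 s x - z0) *
      vector_derivative (circlepath z0 s) (at x within {0..1})) has_integral 2 * of_real pi * \<i> * V) {0..1}"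
    by (simp add: has_contour_integral_def)
  moreover have "\<Phi> (circlepath z0 s x) / (circlepath z0 s x - z0) *
      vector_derivative (circlepath z0 s) (at x within {0..1}) = 2 * of_real pi * \<i> * \<Phi> (circlepath z0 s x)"
    if "x \<in> {0..1}" for x
  proof -
    have "0 \<le> x" "x \<le> 1" using that by auto
    from vector_derivative_circlepath01[OF this] show ?thesis
      using s by (simp only:) (simp add: circlepath)
  qed
  ultimately have "((\<lambda>x. 2 * of_real pi * \<i> * \<Phi> (circlepath z0 s x)) has_integral 2 * of_real pi * \<i> * V) {0..1}"
    by (rule has_integral_eq[rotated]) 
  from has_integral_mult_right[OF this, of "1 / (2 * of_real pi * \<i>)"]
  have "((\<lambda>x. \<Phi> (circlepath z0 s x)) has_integral V) {0..1}" by simp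
  from has_integral_linear[OF this bounded_linear_Re]
  have int: "((\<lambda>x. Re (\<Phi> (circlepath z0 s x))) has_integral Re V) (cbox 0 1)"
    by (simp add: o_def)
  have bdRe: "\<bar>Re (\<Phi> u)\<bar> \<le> K" if u: "cmod (u - z0) = s" for u
  proof -
    define w where "w = u - z0"
    have "w * cnj w = of_real ((cmod w)\<^sup>2)" by (rule complex_norm_square[symmetric])
    then have w: "w * cnj w = of_real s ^ 2" "w \<noteq> 0"
      using u s by (auto simp: w_def)
    have "\<Phi> u = A u + (of_real (Im z0) + (w - of_real s ^ 2 / w) / (2 * \<i>)) * B u"
    proof -
      have "a + b * c + w / d * c - e / d * (c / w) = a + (b + (w - e / w) / d) * c"
        for a b c d e :: complex
        by (simp add: diff_divide_distrib ring_distribs)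
      then show ?thesis unfolding \<Phi>_def f_def w_def .
    qed
    also have "of_real s ^ 2 / w = cnj w" using w by (simp add: field_simps)
    also have "of_real (Im z0) + (w - cnj w) / (2 * \<i>) = of_real (Im u)"
    proof -
      have "(w - cnj w) / (2 * \<i>) = of_real (Im w)"
        unfolding complex_diff_cnj by (subst nonzero_divide_eq_eq) simp_all
      then show ?thesis by (simp add: w_def)
    qed
    finally have "Re (\<Phi> u) = Re (A u) + Im u * Re (B u)" by simp
    moreover have "u \<in> ball z0 r" using u s by (simp add: dist_norm norm_minus_commute)
    ultimately show ?thesis using bd by simp
  qed
  have K: "K \<ge> 0" using bd[of z0] r by (meson abs_ge_zero centre_in_ball order_trans)
  have "norm (Re V) \<le> K * measure lborel (cbox 0 (1::real))"
    by (rule has_integral_bound[OF K int]) (auto intro!: bdRe simp: circlepath norm_mult s less_imp_le)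
  then have V1: "\<bar>Re V\<bar> \<le> K" by simp
  have "Re V = (Re (A z0) + Im z0 * Re (B z0)) + s\<^sup>2 / 2 * Re (\<i> * deriv B z0)"
    by (simp add: V_def f_def power2_eq_square field_simps)
  with V1 bd[of z0] r have "\<bar>s\<^sup>2 / 2 * Re (\<i> * deriv B z0)\<bar> \<le> 2 * K" by simp
  then have "r\<^sup>2 / 8 * \<bar>Re (\<i> * deriv B z0)\<bar> \<le> 2 * K"
    by (simp add: abs_mult s_def power_divide)
  then show ?thesis using r by (simp add: field_simps)
qed

text \<open>Convexity is inherited by the upper part, so that primitives exist on both.\<close>

locale mirror_domain =
  fixes S :: "complex set"
  assumes open_S: "open S" and convex_S: "convex S" and cnj_S: "cnj ` S \<subseteq> S"
begin

lemma cnj_in: "z \<in> S \<Longrightarrow> cnj z \<in> S"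
  using cnj_S by auto

lemma upper_sub: "z \<in> upper_part S \<Longrightarrow> z \<in> S"
  by (simp add: upper_part_def)

lemma vertical_in: "z \<in> S \<Longrightarrow> \<bar>t\<bar> \<le> \<bar>Im z\<bar> \<Longrightarrow> Complex (Re z) t \<in> S"
proof -
  assume z: "z \<in> S" and t: "\<bar>t\<bar> \<le> \<bar>Im z\<bar>"
  have "closed_segment z (cnj z) \<subseteq> S"
    using closed_segment_subset[OF z cnj_in[OF z] convex_S] .
  moreover have "Complex (Re z) t \<in> closed_segment z (cnj z)"
  proof (cases "Im z = 0")
    case True
    then have "Complex (Re z) t = z" using t by (simp add: complex_eq_iff)
    then show ?thesis by simp
  next
    case False
    define l where "l = (1 - t / Im z) / 2"
    have "\<bar>t / Im z\<bar> \<le> 1" using t False by (simp add: abs_divide)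
    then have "- 1 \<le> t / Im z" "t / Im z \<le> 1" by linarith+
    then have "0 \<le> l" "l \<le> 1" by (simp_all add: l_def)
    moreover have "Complex (Re z) t = (1 - l) *\<^sub>R z + l *\<^sub>R cnj z"
      using False by (simp add: complex_eq_iff l_def algebra_simps) (simp add: field_simps)
    ultimately show ?thesis by (auto simp: in_segment)
  qed
  ultimately show ?thesis by blast
qed

text \<open>The function \<open>Re f(x + \<i>t) + c Re f(x - \<i>t)\<close> of \<open>t\<close> has the constant derivative \<open>k\<close>. For \<open>c = - 1\<close>
  and \<open>c = 1\<close> this carries odd and even vertical derivatives over to the function itself.\<close>

lemma reflection_of_vertical_derivative:
  assumes f: "\<And>z. z \<in> S \<Longrightarrow> (f has_field_derivative f' z) (at z)"
    and z: "z \<in> S"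
    and sym: "\<And>w. w \<in> S \<Longrightarrow> Re w = Re z \<Longrightarrow> Re (\<i> * f' w) = c * Re (\<i> * f' (cnj w)) + k"
  shows "Re (f z) + c * Re (f (cnj z)) = (1 + c) * Re (f (of_real (Re z))) + k * Im z"
proof -
  define q where "q = (\<lambda>t. Re (f (Complex (Re z) t)) + c * Re (f (Complex (Re z) (- t))) - k * t)"
  define I where "I = {-\<bar>Im z\<bar>..\<bar>Im z\<bar>}"
  have "\<exists>k. \<forall>t\<in>I. q t = k"
  proof (rule has_field_derivative_zero_constant)
    show "convex I" by (simp add: I_def)
    fix t assume "t \<in> I"
    then have t: "Complex (Re z) t \<in> S" "Complex (Re z) (- t) \<in> S"
      using vertical_in[OF z] by (auto simp: I_def)
    have "((\<lambda>t. Re (f (Complex (Re z) (- t)))) has_real_derivative Re (\<i> * f' (Complex (Re z) (- t))) * (- 1)) (at t)"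
      by (rule DERIV_chain2[where g = uminus, OF Re_has_derivative_vertical[OF f[OF t(2)]]]) (auto intro!: derivative_eq_intros)
    then have "(q has_real_derivative Re (\<i> * f' (Complex (Re z) t)) +
        c * (Re (\<i> * f' (Complex (Re z) (- t))) * (- 1)) - k * 1) (at t)"
      unfolding q_def by (intro DERIV_add DERIV_diff DERIV_cmult DERIV_ident Re_has_derivative_vertical f t)
    moreover have "cnj (Complex (Re z) t) = Complex (Re z) (- t)" by (simp add: complex_eq_iff)
    then have "Re (\<i> * f' (Complex (Re z) t)) + c * (Re (\<i> * f' (Complex (Re z) (- t))) * (- 1)) - k * 1 = 0"
      using sym[OF t(1)] by simp
    ultimately have "(q has_real_derivative 0) (at t)" by (simp only:)
    then show "(q has_real_derivative 0) (at t within I)" by (rule has_field_derivative_at_within)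
  qed
  then obtain q0 where "\<And>t. t \<in> I \<Longrightarrow> q t = q0" by blast
  moreover have "Im z \<in> I" "0 \<in> I"
    using abs_ge_self[of "Im z"] abs_ge_minus_self[of "Im z"] by (auto simp: I_def)
  ultimately have "q (Im z) = q 0" by metis
  moreover have "Complex (Re z) (- Im z) = cnj z" "Complex (Re z) 0 = of_real (Re z)"
    by (auto simp: complex_eq_iff)
  ultimately show ?thesis by (simp add: q_def algebra_simps)
qed

definition vanishes_on_axis :: "(complex \<Rightarrow> real) \<Rightarrow> bool" where
  "vanishes_on_axis g \<longleftrightarrow> (\<forall>p\<in>S. Im p = 0 \<longrightarrow> (g \<longlongrightarrow> 0) (at p within upper_part S))"

lemma vanishes_on_axis_diff:
  "vanishes_on_axis f \<Longrightarrow> vanishes_on_axis g \<Longrightarrow> vanishes_on_axis (\<lambda>z. f z - c * g z)"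
  unfolding vanishes_on_axis_def by (auto intro!: tendsto_eq_intros)

lemma vanishes_on_axis_cong:
  assumes "\<And>z. z \<in> upper_part S \<Longrightarrow> f z = g z"
  shows "vanishes_on_axis f \<longleftrightarrow> vanishes_on_axis g"
proof -
  have "eventually (\<lambda>z. f z = g z) (at p within upper_part S)" for p
    using assms by (simp add: eventually_at_filter)
  from tendsto_cong[OF this] show ?thesis
    unfolding vanishes_on_axis_def by simp
qed

lemma vanishes_on_axisD:
  assumes "vanishes_on_axis g" "p \<in> S" "Im p = 0" "e > 0"
  obtains \<rho> where "\<rho> > 0" "ball p \<rho> \<subseteq> S" "\<And>z. z \<in> ball p \<rho> \<Longrightarrow> Im z > 0 \<Longrightarrow> \<bar>g z\<bar> \<le> e"
proof -
  obtain r where r: "r > 0" "ball p r \<subseteq> S" using open_S assms(2) open_contains_ball by blast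
  have "eventually (\<lambda>z. \<bar>g z\<bar> < e) (at p within upper_part S)"
    using assms tendstoD[of g 0 "at p within upper_part S" e] by (simp add: vanishes_on_axis_def)
  then obtain d where d: "d > 0" "\<And>z. z \<in> upper_part S \<Longrightarrow> z \<noteq> p \<Longrightarrow> dist z p < d \<Longrightarrow> \<bar>g z\<bar> < e"
    unfolding eventually_at by blast
  show ?thesis
  proof (rule that[of "min r d"])
    fix z assume z: "z \<in> ball p (min r d)" "Im z > 0"
    then have "z \<noteq> p" "z \<in> upper_part S" using assms(3) r by (auto simp: upper_part_def)
    then show "\<bar>g z\<bar> \<le> e" using d(2)[of z] z by (simp add: dist_commute)
  qed (use r d in auto)
qed

lemma vanishes_on_axisI:
  assumes "\<And>p e. p \<in> S \<Longrightarrow> Im p = 0 \<Longrightarrow> e > 0 \<Longrightarrow> \<exists>\<rho>>0. \<forall>z\<in>ball p \<rho>. Im z > 0 \<longrightarrow> \<bar>g z\<bar> \<le> e"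
  shows "vanishes_on_axis g"
  unfolding vanishes_on_axis_def
proof (intro ballI impI tendstoI)
  fix p and e :: real assume p: "p \<in> S" "Im p = 0" and e: "e > 0"
  obtain \<rho> where \<rho>: "\<rho> > 0" "\<forall>z\<in>ball p \<rho>. Im z > 0 \<longrightarrow> \<bar>g z\<bar> \<le> e/2"
    using assms[OF p, of "e/2"] e by auto
  have "dist (g z) 0 < e" if "z \<in> upper_part S" "dist z p < \<rho>" for z
  proof -
    have "\<bar>g z\<bar> \<le> e/2" using \<rho>(2) that by (auto simp: upper_part_def dist_commute)
    then show ?thesis using e by simp
  qed
  then show "eventually (\<lambda>z. dist (g z) 0 < e) (at p within upper_part S)"
    unfolding eventually_at using \<rho>(1) by blast
qed

lemma Im_times_vanishes_on_axis:
  assumes "continuous_on S f"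
  shows "vanishes_on_axis (\<lambda>z. Im z * f z)"
  unfolding vanishes_on_axis_def
proof (intro ballI impI)
  fix p assume p: "p \<in> S" "Im p = 0"
  have "isCont f p" using assms open_S p continuous_on_eq_continuous_at by blast
  then have "(f \<longlongrightarrow> f p) (at p within upper_part S)"
    by (simp add: continuous_at_imp_continuous_at_within continuous_within[symmetric])
  then have "((\<lambda>z. Im z * f z) \<longlongrightarrow> Im p * f p) (at p within upper_part S)"
    by (intro tendsto_intros)
  then show "((\<lambda>z. Im z * f z) \<longlongrightarrow> 0) (at p within upper_part S)" using p by simp
qed

lemma Schwarz:
  assumes "F holomorphic_on upper_part S" "vanishes_on_axis (\<lambda>z. Re (F z))"
  obtains G where "G holomorphic_on S" "\<And>z. z \<in> upper_part S \<Longrightarrow> G z = F z"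
    "\<And>z. z \<in> S \<Longrightarrow> G (cnj z) = - cnj (G z)"
  using strong_Schwarz_reflection[OF open_S convex_S cnj_S assms(1)] assms(2)
  unfolding vanishes_on_axis_def by blast

lemma deriv_upper_cong:
  assumes "z \<in> upper_part S" "\<And>z. z \<in> upper_part S \<Longrightarrow> f z = g z"
  shows "deriv f z = deriv g z"
  using assms open_upper_part[OF open_S]
  by (intro deriv_cong_ev) (auto simp: eventually_nhds)

text \<open>Integrating \<open>u\<^sub>y\<close> from the axis gives \<open>u = o(y)\<close>. On the disc around \<open>z\<close> that touches the axis
  Pizzetti's formula then yields \<open>\<Delta>u = o(1/y)\<close>, so the term \<open>y \<Delta>u/2\<close> drops out of \<open>u\<^sub>y\<close> in the
  limit; this is the first claim. For the second, with \<open>a = Re A\<close> and \<open>w = Re (\<i>A' + B)\<close> the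
  identity \<open>y a\<^sub>y - a = y w - u = O(y)\<close> bounds the derivative of \<open>a/y\<close> by \<open>2/y\<close>, so
  \<open>a\<close> is \<open>O(y log 1/y)\<close>.\<close>

lemma clamped_boundary:
  assumes A: "A holomorphic_on upper_part S" and B: "B holomorphic_on upper_part S"
    and 1: "vanishes_on_axis (\<lambda>z. Re (A z) + Im z * Re (B z))"
    and 2: "vanishes_on_axis (\<lambda>z. Re (\<i> * deriv A z + B z) + Im z * Re (\<i> * deriv B z))"
  shows "vanishes_on_axis (\<lambda>z. Re (\<i> * deriv A z + B z))" and "vanishes_on_axis (\<lambda>z. Re (A z))"
proof -
  define g where "g = (\<lambda>z. Re (A z) + Im z * Re (B z))"
  define g' where "g' = (\<lambda>z. Re (\<i> * deriv A z + B z) + Im z * Re (\<i> * deriv B z))"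
  have dA: "(A has_field_derivative deriv A z) (at z)" and dB: "(B has_field_derivative deriv B z) (at z)"
    if "z \<in> upper_part S" for z
    using holomorphic_derivI[OF A open_upper_part[OF open_S] that] holomorphic_derivI[OF B open_upper_part[OF open_S] that]
    by auto
  have dg: "((\<lambda>t. g (Complex x t)) has_real_derivative g' (Complex x t)) (at t)"
    if "Complex x t \<in> upper_part S" for x t
  proof -
    have "((\<lambda>t. Re (A (Complex x t)) + t * Re (B (Complex x t))) has_real_derivative
       Re (\<i> * deriv A (Complex x t)) + (1 * Re (B (Complex x t)) + Re (\<i> * deriv B (Complex x t)) * t)) (at t)"
      using Re_has_derivative_vertical[OF dA[OF that]] Re_has_derivative_vertical[OF dB[OF that]]
      by (intro DERIV_add DERIV_mult DERIV_ident)
    then show ?thesis by (simp add: g_def g'_def algebra_simps)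
  qed
  have g_small: "\<exists>\<rho>>0. ball p \<rho> \<subseteq> S \<and> (\<forall>z\<in>ball p \<rho>. Im z > 0 \<longrightarrow> \<bar>g z\<bar> \<le> e * Im z)"
    if p: "p \<in> S" "Im p = 0" and e: "e > 0" for p e
  proof -
    obtain \<rho> where \<rho>: "\<rho> > 0" "ball p \<rho> \<subseteq> S" "\<And>z. z \<in> ball p \<rho> \<Longrightarrow> Im z > 0 \<Longrightarrow> \<bar>g' z\<bar> \<le> e"
      using vanishes_on_axisD[OF 2 p e] unfolding g'_def by metis
    have "\<bar>g z\<bar> \<le> e * Im z" if z: "z \<in> ball p \<rho>" "Im z > 0" for z
    proof -
      define x where "x = Re z"
      have inb: "Complex x t \<in> ball p \<rho>" if "0 \<le> t" "t \<le> Im z" for t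
      proof -
        have "cmod (p - Complex x t) \<le> cmod (p - z)"
          unfolding cmod_def using that p by (intro real_sqrt_le_mono) (simp add: x_def)
        then show ?thesis using z by (simp add: dist_norm)
      qed
      have x: "of_real x \<in> S" using inb[of 0] \<rho>(2) z by (auto simp: complex_of_real_def)
      have lim: "((\<lambda>t. g (Complex x t)) \<longlongrightarrow> 0) (at_right 0)"
      proof (rule filterlim_compose[OF _ filterlim_vertical_approach])
        have "(g \<longlongrightarrow> 0) (at (of_real x) within upper_part S)"
          using 1 x by (simp add: vanishes_on_axis_def g_def)
        then show "(g \<longlongrightarrow> 0) (at (of_real x) within {z. Im z > 0})"
          by (simp only: at_within_upper_part[OF open_S x])
      qed
      then have lim': "((\<lambda>t. \<bar>g z - g (Complex x t)\<bar>) \<longlongrightarrow> \<bar>g z - 0\<bar>) (at_right 0)"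
        by (intro tendsto_intros)
      have "eventually (\<lambda>t. t \<in> {0<..<Im z}) (at_right 0)"
        using eventually_at_right_real[OF z(2)] .
      then have le: "eventually (\<lambda>t. \<bar>g z - g (Complex x t)\<bar> \<le> e * Im z) (at_right 0)"
      proof eventually_elim
        case (elim t)
        have "norm (g (Complex x (Im z)) - g (Complex x t)) \<le> e * norm (Im z - t)"
        proof (rule field_differentiable_bound[of "{t..Im z}"])
          fix s assume s: "s \<in> {t..Im z}"
          then have *: "Complex x s \<in> ball p \<rho>" "s > 0" using inb[of s] elim by auto
          then have "Complex x s \<in> upper_part S" using \<rho>(2) by (auto simp: upper_part_def)
          then show "((\<lambda>s. g (Complex x s)) has_real_derivative g' (Complex x s)) (at s within {t..Im z})"
            by (rule has_field_derivative_at_within[OF dg])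
          show "norm (g' (Complex x s)) \<le> e" using \<rho>(3)[OF *(1)] *(2) by simp
        qed (use elim in auto)
        also have "e * norm (Im z - t) \<le> e * Im z" using elim e by (intro mult_left_mono) auto
        finally show ?case by (simp add: x_def)
      qed
      show ?thesis using tendsto_upperbound[OF lim' le] by simp
    qed
    with \<rho> show ?thesis by blast
  qed
  have lap: "vanishes_on_axis (\<lambda>z. Im z * Re (\<i> * deriv B z))"
  proof (rule vanishes_on_axisI)
    fix p and e :: real assume p: "p \<in> S" "Im p = 0" and e: "e > 0"
    obtain \<rho> where \<rho>: "\<rho> > 0" "ball p \<rho> \<subseteq> S" "\<And>z. z \<in> ball p \<rho> \<Longrightarrow> Im z > 0 \<Longrightarrow> \<bar>g z\<bar> \<le> e / 32 * Im z"
      \<comment> \<open>The constant \<open>32\<close> is the \<open>16\<close> of \<open>Pizzetti_bound\<close> times the factor \<open>2\<close> by which heights can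
        grow inside the disc.\<close>
      using g_small[OF p, of "e/32"] e by auto
    have "\<bar>Im z * Re (\<i> * deriv B z)\<bar> \<le> e" if z: "z \<in> ball p (\<rho>/2)" "Im z > 0" for z
    proof -
      have sub: "w \<in> ball p \<rho> \<and> Im w > 0 \<and> Im w \<le> 2 * Im z" if w: "w \<in> ball z (Im z)" for w
      proof -
        have "\<bar>Im (w - z)\<bar> \<le> cmod (w - z)" "\<bar>Im (z - p)\<bar> \<le> cmod (z - p)" by (rule abs_Im_le_cmod)+
        then show ?thesis
          using w z p dist_triangle[of p w z] by (auto simp: dist_norm norm_minus_commute)
      qed
      have sub': "ball z (Im z) \<subseteq> upper_part S" using sub \<rho>(2) by (auto simp: upper_part_def)
      have "\<bar>Re (\<i> * deriv B z)\<bar> \<le> 16 * (e / 32 * (2 * Im z)) / (Im z)\<^sup>2"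
      proof (rule Pizzetti_bound[of A])
        fix w assume w: "w \<in> ball z (Im z)"
        have "\<bar>g w\<bar> \<le> e / 32 * Im w" using sub[OF w] by (intro \<rho>) auto
        also have "\<dots> \<le> e / 32 * (2 * Im z)" using sub[OF w] e by (intro mult_left_mono) auto
        finally show "\<bar>Re (A w) + Im w * Re (B w)\<bar> \<le> e / 32 * (2 * Im z)" by (simp add: g_def)
      qed (use A B sub' z in \<open>auto intro: holomorphic_on_subset\<close>)
      then have "Im z * \<bar>Re (\<i> * deriv B z)\<bar> \<le> Im z * (16 * (e / 32 * (2 * Im z)) / (Im z)\<^sup>2)"
        using z by (intro mult_left_mono) auto
      also have "\<dots> = e" using z by (simp add: power2_eq_square)
      finally show ?thesis using z by (simp add: abs_mult)
    qed
    then show "\<exists>\<rho>>0. \<forall>z\<in>ball p \<rho>. Im z > 0 \<longrightarrow> \<bar>Im z * Re (\<i> * deriv B z)\<bar> \<le> e"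
      using \<rho>(1) by (intro exI[of _ "\<rho>/2"]) auto
  qed
  show W: "vanishes_on_axis (\<lambda>z. Re (\<i> * deriv A z + B z))"
    using vanishes_on_axis_diff[OF 2 lap, of 1] by simp
  show "vanishes_on_axis (\<lambda>z. Re (A z))"
    unfolding vanishes_on_axis_def
  proof (intro ballI impI)
    fix p assume p: "p \<in> S" "Im p = 0"
    obtain \<rho>1 where \<rho>1: "\<rho>1 > 0" "ball p \<rho>1 \<subseteq> S" "\<And>z. z \<in> ball p \<rho>1 \<Longrightarrow> Im z > 0 \<Longrightarrow> \<bar>g z\<bar> \<le> 1 * Im z"
      using g_small[OF p, of 1] by auto
    obtain \<rho>2 where \<rho>2: "\<rho>2 > 0" "ball p \<rho>2 \<subseteq> S"
      "\<And>z. z \<in> ball p \<rho>2 \<Longrightarrow> Im z > 0 \<Longrightarrow> \<bar>Re (\<i> * deriv A z + B z)\<bar> \<le> 1"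
      using vanishes_on_axisD[OF W p, of 1] by auto
    define \<rho> where "\<rho> = min \<rho>1 \<rho>2"
    define \<sigma> where "\<sigma> = \<rho> / 4"
    have \<sigma>: "\<sigma> > 0" using \<rho>1 \<rho>2 by (simp add: \<sigma>_def \<rho>_def)
    have box: "z \<in> ball p \<rho>" if "\<bar>Re z - Re p\<bar> \<le> \<sigma>" "\<bar>Im z\<bar> \<le> \<sigma>" for z
      using cmod_le[of "p - z"] that p \<sigma> by (simp add: dist_norm \<sigma>_def abs_minus_commute)
    have box': "z \<in> upper_part S" if "\<bar>Re z - Re p\<bar> \<le> \<sigma>" "0 < Im z" "Im z \<le> \<sigma>" for z
      using box[of z] that \<rho>1 by (auto simp: upper_part_def \<rho>_def)
    have "compact ((\<lambda>z. Re (A z)) ` cbox (Complex (Re p - \<sigma>) \<sigma>) (Complex (Re p + \<sigma>) \<sigma>))"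
      using \<sigma> by (intro compact_continuous_image continuous_intros
          continuous_on_subset[OF holomorphic_on_imp_continuous_on[OF A]])
        (auto simp: in_cbox_complex_iff intro!: box')
    then obtain N where N: "\<And>z. z \<in> cbox (Complex (Re p - \<sigma>) \<sigma>) (Complex (Re p + \<sigma>) \<sigma>) \<Longrightarrow> \<bar>Re (A z)\<bar> \<le> N"
      by (metis bounded_iff compact_imp_bounded image_eqI real_norm_def)
    have bound: "\<bar>Re (A z)\<bar> \<le> Im z * (N / \<sigma>) + 4 * (sqrt \<sigma> * sqrt (Im z))"
      if z: "\<bar>Re z - Re p\<bar> \<le> \<sigma>" "0 < Im z" "Im z < \<sigma>" for z
    proof -
      define x where "x = Re z"
      define a where "a = (\<lambda>t. Re (A (Complex x t)))"
      define a' where "a' = (\<lambda>t. Re (\<i> * deriv A (Complex x t)))"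
      have da: "((\<lambda>t. a t / t) has_real_derivative (a' t * t - a t * 1) / (t * t)) (at t)"
        if "Im z \<le> t" "t \<le> \<sigma>" for t
        unfolding a_def a'_def using that z
        by (intro DERIV_divide DERIV_ident Re_has_derivative_vertical dA box') (auto simp: x_def)
      have ba: "\<bar>(a' t * t - a t * 1) / (t * t)\<bar> \<le> 2 / t" if t: "Im z \<le> t" "t \<le> \<sigma>" for t
      proof -
        define w where "w = Complex x t"
        have w: "w \<in> ball p \<rho>" "Im w > 0" "t > 0" using box[of w] z t by (auto simp: w_def x_def)
        have "a' t * t - a t = t * Re (\<i> * deriv A w + B w) - g w"
          by (simp add: a'_def a_def g_def w_def algebra_simps)
        also have "\<bar>\<dots>\<bar> \<le> \<bar>t * Re (\<i> * deriv A w + B w)\<bar> + \<bar>g w\<bar>" by (rule abs_triangle_ineq4)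
        also have "\<bar>t * Re (\<i> * deriv A w + B w)\<bar> \<le> t * 1"
          using \<rho>2(3)[of w] w unfolding abs_mult by (intro mult_mono) (auto simp: \<rho>_def)
        also have "\<bar>g w\<bar> \<le> t" using \<rho>1(3)[of w] w by (auto simp: \<rho>_def w_def)
        finally have "\<bar>a' t * t - a t * 1\<bar> \<le> 2 * t" by simp
        then have "\<bar>a' t * t - a t * 1\<bar> / (t * t) \<le> 2 * t / (t * t)"
          using w by (intro divide_right_mono) auto
        then show ?thesis using w by (simp add: abs_divide)
      qed
      have "norm (a \<sigma> / \<sigma> - a (Im z) / Im z) \<le> 2 * ln \<sigma> - 2 * ln (Im z)"
      proof (rule differentiable_bound_general)
        show "continuous_on {Im z..\<sigma>} (\<lambda>t. a t / t)"
          by (intro continuous_at_imp_continuous_on ballI DERIV_isCont[OF da]) auto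
        show "continuous_on {Im z..\<sigma>} (\<lambda>t. 2 * ln t)"
          using z by (intro continuous_intros) auto
        fix t assume t: "Im z < t" "t < \<sigma>"
        show "((\<lambda>t. a t / t) has_vector_derivative (a' t * t - a t * 1) / (t * t)) (at t)"
          using da[of t] t by (simp add: has_real_derivative_iff_has_vector_derivative)
        have "((\<lambda>t. 2 * ln t) has_real_derivative 2 / t) (at t)"
          using t z by (auto intro!: derivative_eq_intros)
        then show "((\<lambda>t. 2 * ln t) has_vector_derivative 2 / t) (at t)"
          by (simp add: has_real_derivative_iff_has_vector_derivative)
        show "norm ((a' t * t - a t * 1) / (t * t)) \<le> 2 / t"
          using ba[of t] t by simp
      qed (use z in auto)
      moreover have "\<bar>P - Q\<bar> \<le> 2 * R - 2 * R' \<Longrightarrow> \<bar>Q\<bar> \<le> \<bar>P\<bar> + 2 * (R - R')" for P Q R R' :: real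
        using abs_triangle_ineq2[of Q P] by (simp add: abs_minus_commute)
      ultimately have "\<bar>a (Im z) / Im z\<bar> \<le> \<bar>a \<sigma> / \<sigma>\<bar> + 2 * (ln \<sigma> - ln (Im z))"
        unfolding real_norm_def by blast
      also have "\<bar>a \<sigma> / \<sigma>\<bar> \<le> N / \<sigma>"
        using N[of "Complex x \<sigma>"] z \<sigma> by (simp add: a_def x_def in_cbox_complex_iff abs_le_iff divide_right_mono)
      finally have "\<bar>a (Im z) / Im z\<bar> \<le> N / \<sigma> + 2 * (ln \<sigma> - ln (Im z))" by simp
      then have "Im z * \<bar>a (Im z) / Im z\<bar> \<le> Im z * (N / \<sigma> + 2 * (ln \<sigma> - ln (Im z)))"
        using z by (intro mult_left_mono) auto
      moreover have "Im z * \<bar>a (Im z) / Im z\<bar> = \<bar>Re (A z)\<bar>"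
        using z by (simp add: abs_divide a_def x_def)
      moreover have "Im z * (ln \<sigma> - ln (Im z)) \<le> 2 * (sqrt \<sigma> * sqrt (Im z))"
        by (rule mult_ln_le_sqrt[OF \<sigma> z(2)])
      ultimately show ?thesis by (simp add: algebra_simps)
    qed
    show "((\<lambda>z. Re (A z)) \<longlongrightarrow> 0) (at p within upper_part S)"
    proof (rule Lim_null_comparison)
      have "((\<lambda>z. Im z * (N / \<sigma>) + 4 * (sqrt \<sigma> * sqrt (Im z))) \<longlongrightarrow>
          Im p * (N / \<sigma>) + 4 * (sqrt \<sigma> * sqrt (Im p))) (at p within upper_part S)"
        by (intro tendsto_intros)
      then show "((\<lambda>z. Im z * (N / \<sigma>) + 4 * (sqrt \<sigma> * sqrt (Im z))) \<longlongrightarrow> 0) (at p within upper_part S)"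
        using p by simp
      have "norm (Re (A z)) \<le> Im z * (N / \<sigma>) + 4 * (sqrt \<sigma> * sqrt (Im z))"
        if "z \<in> upper_part S" "dist z p < \<sigma>" for z
        using bound[of z] that abs_Re_le_cmod[of "z - p"] abs_Im_le_cmod[of "z - p"] p
        by (auto simp: upper_part_def dist_norm)
      then show "eventually (\<lambda>z. norm (Re (A z)) \<le> Im z * (N / \<sigma>) + 4 * (sqrt \<sigma> * sqrt (Im z))) (at p within upper_part S)"
        unfolding eventually_at using \<sigma> by blast
    qed
  qed
qed

section \<open>Local continuation under each pair of boundary conditions\<close>

lemma cnj_cpx: "cnj (cpx (x, y)) = cpx (x, - y)"
  by (simp add: cpx_def complex_eq_iff)

lemma mem_cnj_cpx: "cpx (x, y) \<in> S \<Longrightarrow> cpx (x, - y) \<in> S"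
  using cnj_in cnj_cpx by metis

text \<open>A dictionary that turns the four boundary conditions on \<open>u\<close> into conditions on the holomorphic
  functions of its Goursat representation.\<close>

lemma biharmonic_boundary_data:
  assumes "biharmonic_on (cpx -` upper_part S) u"
  obtains A B where "A holomorphic_on upper_part S" "B holomorphic_on upper_part S"
    "\<And>p. cpx p \<in> upper_part S \<Longrightarrow> u p = goursat A B p"
    "vanishes_on_axis (\<lambda>z. u (Re z, Im z)) \<longleftrightarrow> vanishes_on_axis (\<lambda>z. Re (A z) + Im z * Re (B z))"
    "vanishes_on_axis (\<lambda>z. dy u (Re z, Im z)) \<longleftrightarrow>
      vanishes_on_axis (\<lambda>z. Re (\<i> * deriv A z + B z) + Im z * Re (\<i> * deriv B z))"
    "vanishes_on_axis (\<lambda>z. laplacian u (Re z, Im z)) \<longleftrightarrow> vanishes_on_axis (\<lambda>z. Re (2 * \<i> * deriv B z))"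
    "vanishes_on_axis (\<lambda>z. dy (laplacian u) (Re z, Im z)) \<longleftrightarrow> vanishes_on_axis (\<lambda>z. Re (- 2 * deriv (deriv B) z))"
proof -
  note oU = open_upper_part[OF open_S]
  note oV = open_vimage_cpx[OF oU]
  obtain A B where A: "A holomorphic_on upper_part S" and B: "B holomorphic_on upper_part S"
    and u: "\<And>p. p \<in> cpx -` upper_part S \<Longrightarrow> u p = goursat A B p"
    using biharmonic_is_goursat[OF oU convex_upper_part[OF convex_S] assms] by blast
  have mem: "(Re z, Im z) \<in> cpx -` upper_part S" if "z \<in> upper_part S" for z
    using that by simp
  have lap: "laplacian u p = goursat (\<lambda>z. 2 * \<i> * deriv B z) (\<lambda>z. 0) p" if "p \<in> cpx -` upper_part S" for p
    using laplacian_cong[OF oV that u] laplacian_goursat_as_goursat[OF A B oU] that by simp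
  have dB: "deriv B holomorphic_on upper_part S" using B oU by (rule holomorphic_deriv)
  have ddB: "deriv (\<lambda>z. 2 * \<i> * deriv B z) z = 2 * \<i> * deriv (deriv B) z" if "z \<in> upper_part S" for z
    using holomorphic_derivI[OF dB oU that] by (intro DERIV_imp_deriv DERIV_cmult)
  show ?thesis
  proof (rule that[OF A B])
    show "u p = goursat A B p" if "cpx p \<in> upper_part S" for p using u that by simp
    show "vanishes_on_axis (\<lambda>z. u (Re z, Im z)) \<longleftrightarrow> vanishes_on_axis (\<lambda>z. Re (A z) + Im z * Re (B z))"
      by (rule vanishes_on_axis_cong) (simp add: u goursat_def)
    show "vanishes_on_axis (\<lambda>z. dy u (Re z, Im z)) \<longleftrightarrow>
      vanishes_on_axis (\<lambda>z. Re (\<i> * deriv A z + B z) + Im z * Re (\<i> * deriv B z))"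
    proof (rule vanishes_on_axis_cong)
      fix z assume z: "z \<in> upper_part S"
      show "dy u (Re z, Im z) = Re (\<i> * deriv A z + B z) + Im z * Re (\<i> * deriv B z)"
      proof -
        have "dy u (Re z, Im z) = dy (goursat A B) (Re z, Im z)"
          by (rule dy_cong[OF oV mem[OF z] u])
        also have "\<dots> = Re (\<i> * deriv A z + B z) + Im z * Re (\<i> * deriv B z)"
          using partials_goursat(2)[OF A B oU, of "(Re z, Im z)"] z by (simp add: goursat_def)
        finally show ?thesis .
      qed
    qed
    show "vanishes_on_axis (\<lambda>z. laplacian u (Re z, Im z)) \<longleftrightarrow> vanishes_on_axis (\<lambda>z. Re (2 * \<i> * deriv B z))"
      by (rule vanishes_on_axis_cong) (simp add: lap goursat_def)
    show "vanishes_on_axis (\<lambda>z. dy (laplacian u) (Re z, Im z)) \<longleftrightarrow> vanishes_on_axis (\<lambda>z. Re (- 2 * deriv (deriv B) z))"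
    proof (rule vanishes_on_axis_cong)
      fix z assume z: "z \<in> upper_part S"
      have "dy (goursat (\<lambda>z. 2 * \<i> * deriv B z) (\<lambda>z. 0)) (Re z, Im z) = Re (- 2 * deriv (deriv B) z)"
        using partials_goursat(2)[OF _ _ oU, of "\<lambda>z. 2 * \<i> * deriv B z" "\<lambda>z. 0" "(Re z, Im z)"] z dB ddB[OF z]
        by (simp add: goursat_def holomorphic_intros)
      then show "dy (laplacian u) (Re z, Im z) = Re (- 2 * deriv (deriv B) z)"
        using dy_cong[OF oV mem[OF z] lap] by simp
    qed
  qed
qed

text \<open>Here \<open>2\<i>B'\<close> itself reflects, with odd real part. As \<open>2 Re (\<i>B')\<close> is twice the vertical derivative
  of \<open>Re B\<close>, the latter is even.\<close>

lemma extension_laplacian_zero: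
  assumes B: "B holomorphic_on upper_part S" and 0: "vanishes_on_axis (\<lambda>z. Re (2 * \<i> * deriv B z))"
  obtains B1 where "B1 holomorphic_on S" "\<And>z. z \<in> upper_part S \<Longrightarrow> B1 z = B z"
    "\<And>z. z \<in> S \<Longrightarrow> Re (B1 (cnj z)) = Re (B1 z)"
proof -
  have "(\<lambda>z. 2 * \<i> * deriv B z) holomorphic_on upper_part S"
    using B open_upper_part[OF open_S] by (intro holomorphic_intros holomorphic_deriv)
  then obtain G where G: "G holomorphic_on S" "\<And>z. z \<in> upper_part S \<Longrightarrow> G z = 2 * \<i> * deriv B z"
    "\<And>z. z \<in> S \<Longrightarrow> G (cnj z) = - cnj (G z)"
    by (rule Schwarz[OF _ 0]) blast+
  have "(\<lambda>z. - \<i> * G z / 2) holomorphic_on S" using G(1) by (intro holomorphic_intros) auto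
  moreover have "deriv B z = - \<i> * G z / 2" if "z \<in> upper_part S" for z
    using G(2)[OF that] by simp
  ultimately obtain B1 where B1: "B1 holomorphic_on S" "\<And>z. z \<in> upper_part S \<Longrightarrow> B1 z = B z"
    "\<And>z. z \<in> S \<Longrightarrow> (B1 has_field_derivative - \<i> * G z / 2) (at z)"
    by (rule extension_of_primitive[OF open_S convex_S B]) blast+
  have "Re (B1 z) + (- 1) * Re (B1 (cnj z)) = (1 + (- 1)) * Re (B1 (of_real (Re z))) + 0 * Im z" if z: "z \<in> S" for z
  proof (rule reflection_of_vertical_derivative[OF B1(3) z])
    show "Re (\<i> * (- \<i> * G w / 2)) = - 1 * Re (\<i> * (- \<i> * G (cnj w) / 2)) + 0" if "w \<in> S" for w
      using G(3)[OF that] by simp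
  qed
  with B1 show ?thesis by (intro that[of B1]) auto
qed

text \<open>Now \<open>B''\<close> reflects with odd real part. One integration gives an even \<open>Re (\<i>B')\<close>, a second one that
  \<open>Re B\<close> is odd up to its values on the axis, which need not vanish.\<close>

lemma extension_laplacian_flux_zero:
  assumes B: "B holomorphic_on upper_part S" and 0: "vanishes_on_axis (\<lambda>z. Re (- 2 * deriv (deriv B) z))"
  obtains B1 where "B1 holomorphic_on S" "\<And>z. z \<in> upper_part S \<Longrightarrow> B1 z = B z"
    "\<And>z. z \<in> S \<Longrightarrow> Re (B1 z) + Re (B1 (cnj z)) = 2 * Re (B1 (of_real (Re z)))"
proof -
  have dB: "deriv B holomorphic_on upper_part S" using B open_upper_part[OF open_S] by (rule holomorphic_deriv)
  have "(\<lambda>z. - 2 * deriv (deriv B) z) holomorphic_on upper_part S"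
    using open_upper_part[OF open_S] by (intro holomorphic_intros holomorphic_deriv[OF dB])
  then obtain G where G: "G holomorphic_on S" "\<And>z. z \<in> upper_part S \<Longrightarrow> G z = - 2 * deriv (deriv B) z"
    "\<And>z. z \<in> S \<Longrightarrow> G (cnj z) = - cnj (G z)"
    by (rule Schwarz[OF _ 0]) blast+
  have "(\<lambda>z. - G z / 2) holomorphic_on S" using G(1) by (intro holomorphic_intros) auto
  moreover have "deriv (deriv B) z = - G z / 2" if "z \<in> upper_part S" for z
    using G(2)[OF that] by simp
  ultimately obtain b where b: "b holomorphic_on S" "\<And>z. z \<in> upper_part S \<Longrightarrow> b z = deriv B z"
    "\<And>z. z \<in> S \<Longrightarrow> (b has_field_derivative - G z / 2) (at z)"
    by (rule extension_of_primitive[OF open_S convex_S dB]) blast+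
  obtain B1 where B1: "B1 holomorphic_on S" "\<And>z. z \<in> upper_part S \<Longrightarrow> B1 z = B z"
    "\<And>z. z \<in> S \<Longrightarrow> (B1 has_field_derivative b z) (at z)"
    by (rule extension_of_primitive[OF open_S convex_S B b(1)]) (auto simp: b(2))
  have b_even: "Re (\<i> * b z) = Re (\<i> * b (cnj z))" if z: "z \<in> S" for z
  proof -
    have "Re (\<i> * b z) + (- 1) * Re (\<i> * b (cnj z)) = (1 + (- 1)) * Re (\<i> * b (of_real (Re z))) + 0 * Im z"
    proof (rule reflection_of_vertical_derivative[OF _ z])
      show "((\<lambda>z. \<i> * b z) has_field_derivative \<i> * (- G w / 2)) (at w)" if "w \<in> S" for w
        using b(3)[OF that] by (rule DERIV_cmult)
      show "Re (\<i> * (\<i> * (- G w / 2))) = - 1 * Re (\<i> * (\<i> * (- G (cnj w) / 2))) + 0" if "w \<in> S" for w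
        using G(3)[OF that] by simp
    qed
    then show ?thesis by simp
  qed
  have "Re (B1 z) + 1 * Re (B1 (cnj z)) = (1 + 1) * Re (B1 (of_real (Re z))) + 0 * Im z" if z: "z \<in> S" for z
  proof (rule reflection_of_vertical_derivative[OF B1(3) z])
    show "Re (\<i> * b w) = 1 * Re (\<i> * b (cnj w)) + 0" if "w \<in> S" for w
      unfolding mult_1 add_0_right using b_even[OF that] .
  qed
  with B1 show ?thesis by (intro that[of B1]) auto
qed

text \<open>Once \<open>B\<close> continues, \<open>y Re B\<close> vanishes on the axis, so the boundary condition is one on \<open>Re A\<close>.\<close>

lemma extension_value_zero:
  assumes A: "A holomorphic_on upper_part S" and B1: "B1 holomorphic_on S" "\<And>z. z \<in> upper_part S \<Longrightarrow> B1 z = B z"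
    and 0: "vanishes_on_axis (\<lambda>z. Re (A z) + Im z * Re (B z))"
  obtains A1 where "A1 holomorphic_on S" "\<And>z. z \<in> upper_part S \<Longrightarrow> A1 z = A z"
    "\<And>z. z \<in> S \<Longrightarrow> A1 (cnj z) = - cnj (A1 z)"
proof -
  have "vanishes_on_axis (\<lambda>z. Im z * Re (B1 z))"
    using B1(1) by (intro Im_times_vanishes_on_axis continuous_intros holomorphic_on_imp_continuous_on)
  from vanishes_on_axis_diff[OF 0 this, of 1]
  have "vanishes_on_axis (\<lambda>z. Re (A z))"
    by (subst vanishes_on_axis_cong[symmetric]) (auto simp: B1(2))
  then show ?thesis using Schwarz[OF A] that by blast
qed

text \<open>Once \<open>B\<close> continues, the term \<open>y Re (\<i>B')\<close> of \<open>u\<^sub>y\<close> vanishes on the axis, so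
  \<open>W = \<i>A' + B\<close> reflects. Solving for \<open>A'\<close> and integrating gives \<open>A\<close>; only \<open>W\<close> has a simple symmetry.\<close>

lemma extension_slope_zero:
  assumes A: "A holomorphic_on upper_part S" and B1: "B1 holomorphic_on S" "\<And>z. z \<in> upper_part S \<Longrightarrow> B1 z = B z"
    and 0: "vanishes_on_axis (\<lambda>z. Re (\<i> * deriv A z + B z) + Im z * Re (\<i> * deriv B z))"
  obtains A1 W where "A1 holomorphic_on S" "\<And>z. z \<in> upper_part S \<Longrightarrow> A1 z = A z"
    "\<And>z. z \<in> S \<Longrightarrow> (A1 has_field_derivative - \<i> * (W z - B1 z)) (at z)"
    "\<And>z. z \<in> S \<Longrightarrow> Re (W (cnj z)) = - Re (W z)"
proof -
  have dB1: "deriv B1 z = deriv B z" if "z \<in> upper_part S" for z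
    using deriv_upper_cong[OF that B1(2)] .
  have "vanishes_on_axis (\<lambda>z. Im z * Re (\<i> * deriv B1 z))"
    using B1(1) open_S
    by (intro Im_times_vanishes_on_axis continuous_intros holomorphic_on_imp_continuous_on holomorphic_deriv)
  from vanishes_on_axis_diff[OF 0 this, of 1]
  have van: "vanishes_on_axis (\<lambda>z. Re (\<i> * deriv A z + B1 z))"
    by (subst vanishes_on_axis_cong[symmetric]) (auto simp: B1(2) dB1)
  have "(\<lambda>z. \<i> * deriv A z + B1 z) holomorphic_on upper_part S"
    using A B1(1) open_upper_part[OF open_S] upper_sub
    by (intro holomorphic_intros holomorphic_deriv) (auto intro: holomorphic_on_subset)
  then obtain W where W: "W holomorphic_on S" "\<And>z. z \<in> upper_part S \<Longrightarrow> W z = \<i> * deriv A z + B1 z"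
    "\<And>z. z \<in> S \<Longrightarrow> W (cnj z) = - cnj (W z)"
    by (rule Schwarz[OF _ van]) blast+
  have "(\<lambda>z. - \<i> * (W z - B1 z)) holomorphic_on S"
    using W(1) B1(1) by (intro holomorphic_intros)
  moreover have "deriv A z = - \<i> * (W z - B1 z)" if "z \<in> upper_part S" for z
    using W(2)[OF that] by simp
  ultimately obtain A1 where "A1 holomorphic_on S" "\<And>z. z \<in> upper_part S \<Longrightarrow> A1 z = A z"
    "\<And>z. z \<in> S \<Longrightarrow> (A1 has_field_derivative - \<i> * (W z - B1 z)) (at z)"
    by (rule extension_of_primitive[OF open_S convex_S A]) blast+
  then show ?thesis using W(3) by (intro that[of A1 W]) auto
qed

lemma interval_integral_vertical:
  assumes z: "cpx (x, y) \<in> S"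
    and F: "\<And>t. Complex x t \<in> S \<Longrightarrow> (F has_real_derivative f t) (at t)"
    and f: "\<And>t. Complex x t \<in> S \<Longrightarrow> isCont f t"
    and g: "\<And>t. Complex x t \<in> S \<Longrightarrow> g t = f t"
  shows "(LBINT t=ereal 0..ereal (- y). g t) = F (- y) - F 0"
proof -
  have inS: "Complex x t \<in> S" if "min 0 (- y) \<le> t" "t \<le> max 0 (- y)" for t
    using vertical_in[OF z, of t] that by (auto simp: min_def max_def split: if_splits)
  have "(LBINT t=ereal 0..ereal (- y). g t) = (LBINT t=ereal 0..ereal (- y). f t)"
    by (rule interval_integral_cong)
      (auto simp: einterval_iff min_def max_def intro!: g inS split: if_splits)
  also have "\<dots> = F (- y) - F 0"
  proof (rule interval_integral_FTC_finite)
    show "continuous_on {min 0 (- y)..max 0 (- y)} f"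
      by (intro continuous_at_imp_continuous_on ballI f inS) auto
    show "(F has_vector_derivative f t) (at t within {min 0 (- y)..max 0 (- y)})"
      if "min 0 (- y) \<le> t" "t \<le> max 0 (- y)" for t
      using has_field_derivative_at_within[OF F[OF inS[OF that]]]
      by (simp add: has_real_derivative_iff_has_vector_derivative)
  qed
  finally show ?thesis .
qed

text \<open>\<open>T v x y\<close> is the right-hand side of a reflection formula for \<open>v\<close> at the point \<open>(x, y)\<close>.\<close>

definition local_continuation :: "(real \<times> real \<Rightarrow> real) \<Rightarrow> ((real \<times> real \<Rightarrow> real) \<Rightarrow> real \<Rightarrow> real \<Rightarrow> real) \<Rightarrow> bool" where
  "local_continuation u T \<longleftrightarrow> (\<exists>A B. A holomorphic_on S \<and> B holomorphic_on S \<and>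
     (\<forall>p. cpx p \<in> upper_part S \<longrightarrow> u p = goursat A B p) \<and>
     (\<forall>x y. cpx (x, y) \<in> S \<longrightarrow> goursat A B (x, y) = T (goursat A B) x y))"

lemma local_continuationI:
  assumes "A holomorphic_on S" "B holomorphic_on S"
    "\<And>z. z \<in> upper_part S \<Longrightarrow> A z = A' z" "\<And>z. z \<in> upper_part S \<Longrightarrow> B z = B' z"
    "\<And>p. cpx p \<in> upper_part S \<Longrightarrow> u p = goursat A' B' p"
    "\<And>x y. cpx (x, y) \<in> S \<Longrightarrow> goursat A B (x, y) = T (goursat A B) x y"
  shows "local_continuation u T"
  unfolding local_continuation_def
  by (intro exI[of _ A] exI[of _ B]) (use assms in \<open>auto simp: goursat_def\<close>)

text \<open>Both \<open>A\<close> and \<open>W = \<i>A' + B\<close> reflect with odd real parts, which determines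
  \<open>B = W - \<i>A'\<close>. In the formula the terms with \<open>B'\<close> cancel between \<open>2 y u\<^sub>y\<close> and \<open>y\<^sup>2 \<Delta>u\<close>.\<close>

lemma local_continuation_value_slope:
  assumes "biharmonic_on (cpx -` upper_part S) u" "vanishes_on_axis (\<lambda>z. u (Re z, Im z))"
    "vanishes_on_axis (\<lambda>z. dy u (Re z, Im z))"
  shows "local_continuation u (\<lambda>v x y. - v (x, - y) - 2 * y * dy v (x, - y) - y\<^sup>2 * laplacian v (x, - y))"
proof -
  obtain A B where A: "A holomorphic_on upper_part S" and B: "B holomorphic_on upper_part S"
    and u: "\<And>p. cpx p \<in> upper_part S \<Longrightarrow> u p = goursat A B p"
    and 1: "vanishes_on_axis (\<lambda>z. Re (A z) + Im z * Re (B z))"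
    and 2: "vanishes_on_axis (\<lambda>z. Re (\<i> * deriv A z + B z) + Im z * Re (\<i> * deriv B z))"
    by (rule biharmonic_boundary_data[OF assms(1)]) (use assms(2,3) in blast)
  obtain A1 where A1: "A1 holomorphic_on S" "\<And>z. z \<in> upper_part S \<Longrightarrow> A1 z = A z"
    "\<And>z. z \<in> S \<Longrightarrow> A1 (cnj z) = - cnj (A1 z)"
    by (rule Schwarz[OF A clamped_boundary(2)[OF A B 1 2]]) blast
  have "(\<lambda>z. \<i> * deriv A z + B z) holomorphic_on upper_part S"
    using A B open_upper_part[OF open_S] by (intro holomorphic_intros holomorphic_deriv)
  then obtain W where W: "W holomorphic_on S" "\<And>z. z \<in> upper_part S \<Longrightarrow> W z = \<i> * deriv A z + B z"
    "\<And>z. z \<in> S \<Longrightarrow> W (cnj z) = - cnj (W z)"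
    by (rule Schwarz[OF _ clamped_boundary(1)[OF A B 1 2]]) blast+
  define B1 where "B1 = (\<lambda>z. W z - \<i> * deriv A1 z)"
  have B1: "B1 holomorphic_on S"
    unfolding B1_def using A1(1) W(1) open_S by (intro holomorphic_intros holomorphic_deriv)
  have dA1: "deriv A1 (cnj z) = - cnj (deriv A1 z)" if "z \<in> S" for z
    using deriv_cnj_symmetric[OF open_S cnj_S A1(1), of "- 1" z] A1(3) that by simp
  show ?thesis
  proof (rule local_continuationI[OF A1(1) B1 A1(2) _ u])
    show "B1 z = B z" if "z \<in> upper_part S" for z
      using W(2)[OF that] deriv_upper_cong[OF that A1(2)] by (simp add: B1_def)
  next
    fix x y assume z: "cpx (x, y) \<in> S"
    note z' = mem_cnj_cpx[OF z]
    define z where "z = cpx (x, y)"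
    have s: "A1 (cpx (x, - y)) = - cnj (A1 z)" "W (cpx (x, - y)) = - cnj (W z)"
      "deriv A1 (cpx (x, - y)) = - cnj (deriv A1 z)"
      using A1(3) W(3) dA1 z by (auto simp: z_def cnj_cpx[symmetric])
    have lap: "laplacian (goursat A1 B1) (x, - y) = 2 * Re (\<i> * deriv B1 (cpx (x, - y)))"
      by (rule laplacian_goursat[OF A1(1) B1 open_S z'])
    have dy: "dy (goursat A1 B1) (x, - y) = Re (W (cpx (x, - y))) - y * Re (\<i> * deriv B1 (cpx (x, - y)))"
      using partials_goursat(2)[OF A1(1) B1 open_S z'] by (simp add: goursat_def B1_def)
    have v: "goursat A1 B1 (x, - y) = - Re (A1 z) - y * (- Re (W z) + Im (deriv A1 z))"
      by (simp add: goursat_def B1_def s)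
    have v': "goursat A1 B1 (x, y) = Re (A1 z) + y * (Re (W z) + Im (deriv A1 z))"
      by (simp add: goursat_def B1_def z_def)
    show "goursat A1 B1 (x, y) = - goursat A1 B1 (x, - y) - 2 * y * dy (goursat A1 B1) (x, - y)
        - y\<^sup>2 * laplacian (goursat A1 B1) (x, - y)"
      unfolding lap dy v v' s(2) by (simp add: algebra_simps power2_eq_square)
  qed
qed

text \<open>\<open>Re A\<close> is odd and \<open>Re B\<close> is even, so \<open>Re A + y Re B\<close> is odd.\<close>

lemma local_continuation_value_laplacian:
  assumes "biharmonic_on (cpx -` upper_part S) u" "vanishes_on_axis (\<lambda>z. u (Re z, Im z))"
    "vanishes_on_axis (\<lambda>z. laplacian u (Re z, Im z))"
  shows "local_continuation u (\<lambda>v x y. - v (x, - y))"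
proof -
  obtain A B where A: "A holomorphic_on upper_part S" and B: "B holomorphic_on upper_part S"
    and u: "\<And>p. cpx p \<in> upper_part S \<Longrightarrow> u p = goursat A B p"
    and 1: "vanishes_on_axis (\<lambda>z. Re (A z) + Im z * Re (B z))"
    and 2: "vanishes_on_axis (\<lambda>z. Re (2 * \<i> * deriv B z))"
    by (rule biharmonic_boundary_data[OF assms(1)]) (use assms(2,3) in blast)
  obtain B1 where B1: "B1 holomorphic_on S" "\<And>z. z \<in> upper_part S \<Longrightarrow> B1 z = B z"
    "\<And>z. z \<in> S \<Longrightarrow> Re (B1 (cnj z)) = Re (B1 z)"
    using extension_laplacian_zero[OF B 2] by blast
  obtain A1 where A1: "A1 holomorphic_on S" "\<And>z. z \<in> upper_part S \<Longrightarrow> A1 z = A z"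
    "\<And>z. z \<in> S \<Longrightarrow> A1 (cnj z) = - cnj (A1 z)"
    using extension_value_zero[OF A B1(1,2) 1] by blast
  show ?thesis
  proof (rule local_continuationI[OF A1(1) B1(1) A1(2) B1(2) u])
    fix x y assume "cpx (x, y) \<in> S"
    then show "goursat A1 B1 (x, y) = - goursat A1 B1 (x, - y)"
      using A1(3) B1(3) by (simp add: goursat_def cnj_cpx[symmetric])
  qed
qed

text \<open>\<open>Re A\<close> is odd. Since \<open>\<Delta>v\<close> is the vertical derivative of \<open>2 Re B\<close>, the integral is
  \<open>2 Re B(x - \<i>y) - 2 Re B(x)\<close>, and the symmetry of \<open>B\<close> replaces \<open>2 Re B(x)\<close> by the sum of the
  values of \<open>Re B\<close> at \<open>x + \<i>y\<close> and \<open>x - \<i>y\<close>.\<close>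

lemma local_continuation_value_flux:
  assumes "biharmonic_on (cpx -` upper_part S) u" "vanishes_on_axis (\<lambda>z. u (Re z, Im z))"
    "vanishes_on_axis (\<lambda>z. dy (laplacian u) (Re z, Im z))"
  shows "local_continuation u (\<lambda>v x y. - v (x, - y) - y * (LBINT t=ereal 0..ereal (- y). laplacian v (x, t)))"
proof -
  obtain A B where A: "A holomorphic_on upper_part S" and B: "B holomorphic_on upper_part S"
    and u: "\<And>p. cpx p \<in> upper_part S \<Longrightarrow> u p = goursat A B p"
    and 1: "vanishes_on_axis (\<lambda>z. Re (A z) + Im z * Re (B z))"
    and 2: "vanishes_on_axis (\<lambda>z. Re (- 2 * deriv (deriv B) z))"
    by (rule biharmonic_boundary_data[OF assms(1)]) (use assms(2,3) in blast)
  obtain B1 where B1: "B1 holomorphic_on S" "\<And>z. z \<in> upper_part S \<Longrightarrow> B1 z = B z"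
    "\<And>z. z \<in> S \<Longrightarrow> Re (B1 z) + Re (B1 (cnj z)) = 2 * Re (B1 (of_real (Re z)))"
    using extension_laplacian_flux_zero[OF B 2] by blast
  obtain A1 where A1: "A1 holomorphic_on S" "\<And>z. z \<in> upper_part S \<Longrightarrow> A1 z = A z"
    "\<And>z. z \<in> S \<Longrightarrow> A1 (cnj z) = - cnj (A1 z)"
    using extension_value_zero[OF A B1(1,2) 1] by blast
  have dB1: "(B1 has_field_derivative deriv B1 z) (at z)" if "z \<in> S" for z
    using holomorphic_derivI[OF B1(1) open_S that] .
  have ddB1: "(deriv B1 has_field_derivative deriv (deriv B1) z) (at z)" if "z \<in> S" for z
    using holomorphic_derivI[OF holomorphic_deriv[OF B1(1) open_S] open_S that] .
  show ?thesis
  proof (rule local_continuationI[OF A1(1) B1(1) A1(2) B1(2) u])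
    fix x y assume z: "cpx (x, y) \<in> S"
    have int: "(LBINT t=ereal 0..ereal (- y). laplacian (goursat A1 B1) (x, t)) =
        2 * Re (B1 (Complex x (- y))) - 2 * Re (B1 (Complex x 0))"
    proof (rule interval_integral_vertical[OF z])
      fix t assume t: "Complex x t \<in> S"
      show "((\<lambda>t. 2 * Re (B1 (Complex x t))) has_real_derivative 2 * Re (\<i> * deriv B1 (Complex x t))) (at t)"
        by (intro DERIV_cmult Re_has_derivative_vertical dB1 t)
      show "isCont (\<lambda>t. 2 * Re (\<i> * deriv B1 (Complex x t))) t"
        using has_vector_derivative_continuous[OF has_vector_derivative_vertical[OF ddB1[OF t]]]
        by (intro continuous_mult continuous_const continuous_ident continuous_Re)
      show "laplacian (goursat A1 B1) (x, t) = 2 * Re (\<i> * deriv B1 (Complex x t))"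
        using laplacian_goursat[OF A1(1) B1(1) open_S, of "(x, t)"] t by (simp add: cpx_def)
    qed
    have "Complex x (- y) = cnj (cpx (x, y))" "Complex x 0 = of_real (Re (cpx (x, y)))"
      by (simp_all add: complex_eq_iff)
    then have int': "(LBINT t=ereal 0..ereal (- y). laplacian (goursat A1 B1) (x, t)) =
        Re (B1 (cnj (cpx (x, y)))) - Re (B1 (cpx (x, y)))"
      using int B1(3)[OF z] by simp
    show "goursat A1 B1 (x, y) = - goursat A1 B1 (x, - y)
        - y * (LBINT t=ereal 0..ereal (- y). laplacian (goursat A1 B1) (x, t))"
      unfolding int' using A1(3)[OF z] by (simp add: goursat_def cnj_cpx[symmetric] algebra_simps)
  qed
qed

text \<open>\<open>Re B\<close> is even and \<open>Re W\<close> is odd for \<open>W = \<i>A' + B\<close>. Integration by parts evaluates the integral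
  with the help of a function \<open>C\<close> for which \<open>Re C\<close> is a vertical primitive of \<open>Re B\<close>. As \<open>Re W\<close> is
  the vertical derivative of \<open>Re (A + C)\<close>, the latter is even, while \<open>Re C\<close> is odd up to
  its values on the axis.\<close>

lemma local_continuation_slope_laplacian:
  assumes "biharmonic_on (cpx -` upper_part S) u" "vanishes_on_axis (\<lambda>z. dy u (Re z, Im z))"
    "vanishes_on_axis (\<lambda>z. laplacian u (Re z, Im z))"
  shows "local_continuation u (\<lambda>v x y. v (x, - y) - (LBINT t=ereal 0..ereal (- y). t * laplacian v (x, t)))"
proof -
  obtain A B where A: "A holomorphic_on upper_part S" and B: "B holomorphic_on upper_part S"
    and u: "\<And>p. cpx p \<in> upper_part S \<Longrightarrow> u p = goursat A B p"
    and 1: "vanishes_on_axis (\<lambda>z. Re (\<i> * deriv A z + B z) + Im z * Re (\<i> * deriv B z))"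
    and 2: "vanishes_on_axis (\<lambda>z. Re (2 * \<i> * deriv B z))"
    by (rule biharmonic_boundary_data[OF assms(1)]) (use assms(2,3) in blast)
  obtain B1 where B1: "B1 holomorphic_on S" "\<And>z. z \<in> upper_part S \<Longrightarrow> B1 z = B z"
    "\<And>z. z \<in> S \<Longrightarrow> Re (B1 (cnj z)) = Re (B1 z)"
    using extension_laplacian_zero[OF B 2] by blast
  obtain A1 W where A1: "A1 holomorphic_on S" "\<And>z. z \<in> upper_part S \<Longrightarrow> A1 z = A z"
    "\<And>z. z \<in> S \<Longrightarrow> (A1 has_field_derivative - \<i> * (W z - B1 z)) (at z)"
    and W: "\<And>z. z \<in> S \<Longrightarrow> Re (W (cnj z)) = - Re (W z)"
    using extension_slope_zero[OF A B1(1,2) 1] by blast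
  have "(\<lambda>z. - \<i> * B1 z) holomorphic_on S" using B1(1) by (intro holomorphic_intros)
  then obtain C where C: "\<And>z. z \<in> S \<Longrightarrow> (C has_field_derivative - \<i> * B1 z) (at z)"
    using holomorphic_primitive[OF _ convex_S open_S] by blast
  have dB1: "(B1 has_field_derivative deriv B1 z) (at z)" if "z \<in> S" for z
    using holomorphic_derivI[OF B1(1) open_S that] .
  have ddB1: "(deriv B1 has_field_derivative deriv (deriv B1) z) (at z)" if "z \<in> S" for z
    using holomorphic_derivI[OF holomorphic_deriv[OF B1(1) open_S] open_S that] .
  have C_odd: "Re (C z) + 1 * Re (C (cnj z)) = (1 + 1) * Re (C (of_real (Re z))) + 0 * Im z" if z: "z \<in> S" for z
    by (rule reflection_of_vertical_derivative[OF C z]) (simp_all add: B1(3))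
  have AC: "Re (A1 z + C z) + (- 1) * Re (A1 (cnj z) + C (cnj z)) =
      (1 + (- 1)) * Re (A1 (of_real (Re z)) + C (of_real (Re z))) + 0 * Im z" if z: "z \<in> S" for z
  proof (rule reflection_of_vertical_derivative[OF _ z])
    show "((\<lambda>z. A1 z + C z) has_field_derivative - \<i> * W w) (at w)" if "w \<in> S" for w
      using DERIV_add[OF A1(3)[OF that] C[OF that]] by (simp add: algebra_simps)
  qed (simp add: W)
  show ?thesis
  proof (rule local_continuationI[OF A1(1) B1(1) A1(2) B1(2) u])
    fix x y assume z: "cpx (x, y) \<in> S"
    have int: "(LBINT t=ereal 0..ereal (- y). t * laplacian (goursat A1 B1) (x, t)) =
        (2 * ((- y) * Re (B1 (Complex x (- y))) - Re (C (Complex x (- y)))))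
         - (2 * (0 * Re (B1 (Complex x 0)) - Re (C (Complex x 0))))"
    proof (rule interval_integral_vertical[OF z])
      fix t assume t: "Complex x t \<in> S"
      have "((\<lambda>t. 2 * (t * Re (B1 (Complex x t)) - Re (C (Complex x t)))) has_real_derivative
          2 * ((1 * Re (B1 (Complex x t)) + Re (\<i> * deriv B1 (Complex x t)) * t) - Re (\<i> * (- \<i> * B1 (Complex x t))))) (at t)"
        by (intro DERIV_cmult DERIV_diff DERIV_mult DERIV_ident Re_has_derivative_vertical dB1 C t)
      then show "((\<lambda>t. 2 * (t * Re (B1 (Complex x t)) - Re (C (Complex x t)))) has_real_derivative
          t * (2 * Re (\<i> * deriv B1 (Complex x t)))) (at t)"
        by (simp add: algebra_simps)
      show "isCont (\<lambda>t. t * (2 * Re (\<i> * deriv B1 (Complex x t)))) t"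
        using has_vector_derivative_continuous[OF has_vector_derivative_vertical[OF ddB1[OF t]]]
        by (intro continuous_mult continuous_const continuous_ident continuous_Re)
      show "t * laplacian (goursat A1 B1) (x, t) = t * (2 * Re (\<i> * deriv B1 (Complex x t)))"
        using laplacian_goursat[OF A1(1) B1(1) open_S, of "(x, t)"] t by (simp add: cpx_def)
    qed
    have "Complex x (- y) = cnj (cpx (x, y))" "Complex x 0 = of_real (Re (cpx (x, y)))"
      by (simp_all add: complex_eq_iff)
    then have int': "(LBINT t=ereal 0..ereal (- y). t * laplacian (goursat A1 B1) (x, t)) =
        - 2 * y * Re (B1 (cpx (x, y))) - 2 * Re (C (cnj (cpx (x, y)))) + (Re (C (cpx (x, y))) + Re (C (cnj (cpx (x, y)))))"
      using int B1(3)[OF z] C_odd[OF z] by simp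
    show "goursat A1 B1 (x, y) = goursat A1 B1 (x, - y)
        - (LBINT t=ereal 0..ereal (- y). t * laplacian (goursat A1 B1) (x, t))"
      unfolding int' using AC[OF z] B1(3)[OF z] by (simp add: goursat_def cnj_cpx[symmetric] algebra_simps)
  qed
qed

text \<open>\<open>Re A\<close> and \<open>y Re B\<close> are not even one by one: both jump under reflection by
  \<open>2 y Re B(x)\<close>, with opposite signs.\<close>

lemma local_continuation_slope_flux:
  assumes "biharmonic_on (cpx -` upper_part S) u" "vanishes_on_axis (\<lambda>z. dy u (Re z, Im z))"
    "vanishes_on_axis (\<lambda>z. dy (laplacian u) (Re z, Im z))"
  shows "local_continuation u (\<lambda>v x y. v (x, - y))"
proof -
  obtain A B where A: "A holomorphic_on upper_part S" and B: "B holomorphic_on upper_part S"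
    and u: "\<And>p. cpx p \<in> upper_part S \<Longrightarrow> u p = goursat A B p"
    and 1: "vanishes_on_axis (\<lambda>z. Re (\<i> * deriv A z + B z) + Im z * Re (\<i> * deriv B z))"
    and 2: "vanishes_on_axis (\<lambda>z. Re (- 2 * deriv (deriv B) z))"
    by (rule biharmonic_boundary_data[OF assms(1)]) (use assms(2,3) in blast)
  obtain B1 where B1: "B1 holomorphic_on S" "\<And>z. z \<in> upper_part S \<Longrightarrow> B1 z = B z"
    "\<And>z. z \<in> S \<Longrightarrow> Re (B1 z) + Re (B1 (cnj z)) = 2 * Re (B1 (of_real (Re z)))"
    using extension_laplacian_flux_zero[OF B 2] by blast
  obtain A1 W where A1: "A1 holomorphic_on S" "\<And>z. z \<in> upper_part S \<Longrightarrow> A1 z = A z"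
    "\<And>z. z \<in> S \<Longrightarrow> (A1 has_field_derivative - \<i> * (W z - B1 z)) (at z)"
    and W: "\<And>z. z \<in> S \<Longrightarrow> Re (W (cnj z)) = - Re (W z)"
    using extension_slope_zero[OF A B1(1,2) 1] by blast
  have A1_refl: "Re (A1 z) + (- 1) * Re (A1 (cnj z)) =
      (1 + (- 1)) * Re (A1 (of_real (Re z))) + (- 2 * Re (B1 (of_real (Re z)))) * Im z" if z: "z \<in> S" for z
  proof (rule reflection_of_vertical_derivative[OF A1(3) z])
    fix w assume w: "w \<in> S" "Re w = Re z"
    show "Re (\<i> * (- \<i> * (W w - B1 w))) = - 1 * Re (\<i> * (- \<i> * (W (cnj w) - B1 (cnj w)))) + - 2 * Re (B1 (of_real (Re z)))"
      using W[OF w(1)] B1(3)[OF w(1)] w(2) by simp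
  qed
  show ?thesis
  proof (rule local_continuationI[OF A1(1) B1(1) A1(2) B1(2) u])
    fix x y assume z: "cpx (x, y) \<in> S"
    have "Re (A1 (cpx (x, y))) - Re (A1 (cnj (cpx (x, y)))) = - (Re (B1 (cpx (x, y))) + Re (B1 (cnj (cpx (x, y))))) * y"
      using A1_refl[OF z] B1(3)[OF z] by simp
    then show "goursat A1 B1 (x, y) = goursat A1 B1 (x, - y)"
      by (simp add: goursat_def cnj_cpx[symmetric] algebra_simps)
  qed
qed

end

section \<open>Unique continuation and global continuation\<close>

text \<open>If \<open>F\<close> were not constant, the image of \<open>T'\<close> would be open, but it lies on the imaginary axis.\<close>

lemma Re_zero_continuation:
  assumes F: "F holomorphic_on T" and T: "open T" "connected T"
    and T': "open T'" "T' \<subseteq> T" "T' \<noteq> {}"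
    and 0: "\<And>z. z \<in> T' \<Longrightarrow> Re (F z) = 0" and z: "z \<in> T"
  shows "Re (F z) = 0"
proof -
  have "F constant_on T"
  proof (rule ccontr)
    assume "\<not> F constant_on T"
    then have o: "open (F ` T')" using open_mapping_thm[OF F T T'(1,2)] by blast
    obtain w where w: "w \<in> T'" using T' by blast
    obtain e where e: "e > 0" "ball (F w) e \<subseteq> F ` T'"
      using o w open_contains_ball by blast
    have "F w + of_real (e/2) \<in> ball (F w) e" using e by (simp add: dist_norm)
    then obtain w' where "w' \<in> T'" "F w + of_real (e/2) = F w'" using e by blast
    then have "Re (F w) + e/2 = Re (F w')" by (metis Re_complex_of_real plus_complex.sel(1))
    then show False using 0 w \<open>w' \<in> T'\<close> e by simp
  qed
  then show ?thesis using 0 z T' unfolding constant_on_def by (metis equals0I subsetD)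
qed

text \<open>Apply \<open>Re_zero_continuation\<close> first to the Laplacian, which is the real part of a holomorphic
  function; then the function is harmonic, so it is a real part itself.\<close>

lemma goursat_zero_continuation:
  assumes A: "A holomorphic_on T" and B: "B holomorphic_on T" and T: "open T" "convex T"
    and T': "open T'" "T' \<subseteq> T" "T' \<noteq> {}"
    and 0: "\<And>p. cpx p \<in> T' \<Longrightarrow> goursat A B p = 0" and p: "cpx p \<in> T"
  shows "goursat A B p = 0"
proof -
  have zero: "laplacian (\<lambda>p. 0) p = 0" for p
    by (simp add: laplacian_def dx_def dy_def)
  have lap: "laplacian (goursat A B) p = Re (2 * \<i> * deriv B (cpx p))" if "cpx p \<in> T" for p
    using laplacian_goursat[OF A B T(1) that] by simp
  have hol: "(\<lambda>z. 2 * \<i> * deriv B z) holomorphic_on T"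
    using B T by (intro holomorphic_intros holomorphic_deriv)
  have lap0: "Re (2 * \<i> * deriv B z) = 0" if "z \<in> T" for z
  proof (rule Re_zero_continuation[OF hol T(1) convex_connected[OF T(2)] T' _ that])
    fix z assume z: "z \<in> T'"
    have "laplacian (goursat A B) (Re z, Im z) = laplacian (\<lambda>p. 0) (Re z, Im z)"
      by (rule laplacian_cong[OF open_vimage_cpx[OF T'(1)]]) (use z 0 in auto)
    then show "Re (2 * \<i> * deriv B z) = 0"
      using lap[of "(Re z, Im z)"] z T'(2) zero by auto
  qed
  have "laplacian (goursat A B) p = 0" if "p \<in> cpx -` T" for p
    using lap[of p] lap0[of "cpx p"] that by simp
  then obtain F where F: "F holomorphic_on T" "\<And>p. p \<in> cpx -` T \<Longrightarrow> goursat A B p = Re (F (cpx p))"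
    using harmonic_is_Re[OF T Ck_on_goursat[OF A B T(1)]] by metis
  have "Re (F (cpx p)) = 0"
  proof (rule Re_zero_continuation[OF F(1) T(1) convex_connected[OF T(2)] T' _ p])
    fix z assume "z \<in> T'"
    then show "Re (F z) = 0" using F(2)[of "(Re z, Im z)"] 0[of "(Re z, Im z)"] T'(2) by auto
  qed
  then show ?thesis using F(2)[of p] p by simp
qed

lemma biharmonic_on_cong:
  assumes "open S" "\<And>p. p \<in> S \<Longrightarrow> f p = g p" "biharmonic_on S f"
  shows "biharmonic_on S g"
  unfolding biharmonic_on_def
proof (intro conjI ballI)
  show "Ck_on 4 S g" using assms Ck_on_cong[OF assms(1,2)] by (simp add: biharmonic_on_def)
  fix p assume p: "p \<in> S"
  have "laplacian (laplacian f) p = laplacian (laplacian g) p"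
    by (rule laplacian_cong[OF assms(1) p]) (rule laplacian_cong[OF assms(1) _ assms(2)])
  then show "laplacian (laplacian g) p = 0" using assms(3) p by (simp add: biharmonic_on_def)
qed

lemma biharmonic_on_locally:
  assumes "\<And>p. p \<in> S \<Longrightarrow> \<exists>T. open T \<and> p \<in> T \<and> biharmonic_on T f"
  shows "biharmonic_on S f"
  unfolding biharmonic_on_def
proof
  show "Ck_on 4 S f"
    using assms unfolding biharmonic_on_def by (intro Ck_on_locally) blast
  show "\<forall>p\<in>S. laplacian (laplacian f) p = 0"
    using assms unfolding biharmonic_on_def by blast
qed

text \<open>The intersection of two mirror-symmetric convex domains that meet contains a piece of the axis,
  hence points above it, where the two functions agree.\<close>

lemma goursat_uniqueness:
  assumes S: "mirror_domain S" "A holomorphic_on S" "B holomorphic_on S"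
    and S': "mirror_domain S'" "A' holomorphic_on S'" "B' holomorphic_on S'"
    and eq: "\<And>p. cpx p \<in> upper_part (S \<inter> S') \<Longrightarrow> goursat A B p = goursat A' B' p"
    and p: "cpx p \<in> S \<inter> S'"
  shows "goursat A B p = goursat A' B' p"
proof -
  interpret M: mirror_domain S by (rule S)
  interpret N: mirror_domain S' by (rule S')
  define T where "T = S \<inter> S'"
  have T: "open T" "convex T"
    using M.open_S N.open_S M.convex_S N.convex_S by (auto simp: T_def convex_Int)
  have hol: "(\<lambda>z. A z - A' z) holomorphic_on T" "(\<lambda>z. B z - B' z) holomorphic_on T"
    using S S' by (auto simp: T_def intro!: holomorphic_intros intro: holomorphic_on_subset)
  have diff: "goursat (\<lambda>z. A z - A' z) (\<lambda>z. B z - B' z) p = goursat A B p - goursat A' B' p" for p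
    by (simp add: goursat_def algebra_simps)
  have ne: "upper_part T \<noteq> {}"
  proof -
    have "Complex (Re (cpx p)) 0 \<in> S" "Complex (Re (cpx p)) 0 \<in> S'"
      using M.vertical_in[of "cpx p" 0] N.vertical_in[of "cpx p" 0] p by auto
    then have "Complex (fst p) 0 \<in> T" by (simp add: T_def)
    then obtain e where e: "e > 0" "ball (Complex (fst p) 0) e \<subseteq> T"
      using T(1) open_contains_ball by blast
    have "Complex (fst p) (e/2) \<in> ball (Complex (fst p) 0) e"
      using e(1) by (simp add: dist_norm cmod_def)
    then have "Complex (fst p) (e/2) \<in> upper_part T"
      using e by (auto simp: upper_part_def)
    then show ?thesis by blast
  qed
  have "goursat (\<lambda>z. A z - A' z) (\<lambda>z. B z - B' z) p = 0"
  proof (rule goursat_zero_continuation[OF hol T open_upper_part[OF T(1)] _ ne])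
    show "upper_part T \<subseteq> T" by (auto simp: upper_part_def)
    show "goursat (\<lambda>z. A z - A' z) (\<lambda>z. B z - B' z) p = 0" if "cpx p \<in> upper_part T" for p
      using eq[of p] that by (simp add: diff T_def)
    show "cpx p \<in> T" using p by (simp add: T_def)
  qed
  then show ?thesis by (simp add: diff)
qed

text \<open>An \<open>\<epsilon>\<close>-neighbourhood of a segment is convex, being the Minkowski sum of the segment and a disc.\<close>

lemma mirror_domain_around_segment:
  assumes U: "open U" and seg: "\<And>t. \<bar>t\<bar> \<le> \<bar>y\<bar> \<Longrightarrow> (x, t) \<in> U"
  obtains S where "mirror_domain S" "cpx -` S \<subseteq> U" "cpx (x, y) \<in> S"
proof -
  \<comment> \<open>The segment is symmetric in the axis, and so is its neighbourhood.\<close>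
  define K where "K = closed_segment (Complex x (- \<bar>y\<bar>)) (Complex x \<bar>y\<bar>)"
  have memK: "z \<in> K \<longleftrightarrow> Re z = x \<and> \<bar>Im z\<bar> \<le> \<bar>y\<bar>" for z
    unfolding K_def by (auto simp: closed_segment_same_Re closed_segment_eq_real_ivl abs_le_iff)
  define U' where "U' = (\<lambda>z. (Re z, Im z)) -` U"
  have oU': "open U'"
    unfolding U'_def by (intro open_vimage U continuous_intros)
  have "K \<subseteq> U'"
  proof
    fix z assume "z \<in> K"
    then have "Re z = x" "\<bar>Im z\<bar> \<le> \<bar>y\<bar>" by (auto simp: memK)
    then show "z \<in> U'" using seg[of "Im z"] by (simp add: U'_def)
  qed
  then obtain \<epsilon> where \<epsilon>: "\<epsilon> > 0" "(\<Union>k\<in>K. ball k \<epsilon>) \<subseteq> U'"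
    using compact_subset_open_imp_ball_epsilon_subset[OF _ oU', of K] by (auto simp: K_def)
  define S where "S = (\<Union>k\<in>K. ball k \<epsilon>)"
  have "S = (\<Union>k\<in>K. \<Union>b\<in>ball 0 \<epsilon>. {k + b})"
  proof -
    have "ball k \<epsilon> = (\<Union>b\<in>ball 0 \<epsilon>. {k + b})" for k :: complex
    proof (intro equalityI subsetI)
      fix w assume "w \<in> ball k \<epsilon>"
      then have "w - k \<in> ball 0 \<epsilon>" "w = k + (w - k)" by (auto simp: dist_norm norm_minus_commute)
      then show "w \<in> (\<Union>b\<in>ball 0 \<epsilon>. {k + b})" by blast
    qed (auto simp: dist_norm)
    then show ?thesis unfolding S_def by (intro SUP_cong refl)
  qed
  then have "convex S"
    using convex_sums[of K "ball 0 \<epsilon>"] by (simp add: K_def convex_closed_segment)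
  moreover have "open S" by (auto simp: S_def)
  moreover have "cnj ` S \<subseteq> S"
  proof safe
    fix z assume "z \<in> S"
    then obtain k where k: "k \<in> K" "dist k z < \<epsilon>" by (auto simp: S_def)
    have "dist (cnj k) (cnj z) = dist k z"
      by (metis complex_cnj_diff complex_mod_cnj dist_norm)
    moreover have "cnj k \<in> K" using k by (simp add: memK)
    ultimately show "cnj z \<in> S" using k unfolding S_def by force
  qed
  ultimately have 1: "mirror_domain S" by unfold_locales
  have "cpx -` S \<subseteq> U"
  proof
    fix p assume "p \<in> cpx -` S"
    then have "cpx p \<in> U'" using \<epsilon>(2) unfolding S_def by blast
    then show "p \<in> U" by (simp add: U'_def)
  qed
  moreover have "cpx (x, y) \<in> K" by (simp add: memK)
  then have "cpx (x, y) \<in> S" using \<epsilon>(1) unfolding S_def by force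
  ultimately show ?thesis using that 1 by blast
qed

text \<open>On and below the axis the continuation takes the value of any local continuation near the point;
  \<open>goursat_uniqueness\<close> makes the choice immaterial, so it agrees with each local continuation on
  the whole domain of the latter and inherits its formula.\<close>

lemma continuation_from_local:
  fixes U U1 :: "(real \<times> real) set" and T :: "(real \<times> real \<Rightarrow> real) \<Rightarrow> real \<Rightarrow> real \<Rightarrow> real"
  assumes U: "open U" and U1: "U1 = {p \<in> U. snd p > 0}" and u: "biharmonic_on U1 u"
    and small: "\<And>x y t. (x, y) \<in> U \<Longrightarrow> y \<le> 0 \<Longrightarrow> \<bar>t\<bar> \<le> \<bar>y\<bar> \<Longrightarrow> (x, t) \<in> U"
    and local: "\<And>S. mirror_domain S \<Longrightarrow> cpx -` S \<subseteq> U \<Longrightarrow> mirror_domain.local_continuation S u T"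
    and cong: "\<And>S f g x y. mirror_domain S \<Longrightarrow> cpx (x, y) \<in> S \<Longrightarrow>
      (\<And>p. p \<in> cpx -` S \<Longrightarrow> f p = g p) \<Longrightarrow> T f x y = T g x y"
  shows "\<exists>v. biharmonic_continuation U1 U u v \<and>
    (\<forall>x0 y0. (x0, y0) \<in> U1 \<and> (x0, - y0) \<in> U \<longrightarrow> u (x0, y0) = T v x0 y0)"
proof -
  define good where "good = (\<lambda>S A B. mirror_domain S \<and> cpx -` S \<subseteq> U \<and> A holomorphic_on S \<and> B holomorphic_on S \<and>
    (\<forall>p. cpx p \<in> upper_part S \<longrightarrow> u p = goursat A B p) \<and>
     (\<forall>x y. cpx (x, y) \<in> S \<longrightarrow> goursat A B (x, y) = T (goursat A B) x y))"
  have ex: "\<exists>S A B. good S A B \<and> cpx p \<in> S" if p: "p \<in> U" "snd p \<le> 0" for p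
  proof -
    obtain x y where xy: "p = (x, y)" by (cases p)
    obtain S where S: "mirror_domain S" "cpx -` S \<subseteq> U" "cpx (x, y) \<in> S"
      using mirror_domain_around_segment[OF U, of y x] small p xy by auto
    from local[OF S(1,2)] have "\<exists>A B. good S A B"
      unfolding mirror_domain.local_continuation_def[OF S(1)] good_def using S by blast
    then show ?thesis using S xy by blast
  qed
  then obtain S A B where SAB: "\<And>p. p \<in> U \<Longrightarrow> snd p \<le> 0 \<Longrightarrow> good (S p) (A p) (B p) \<and> cpx p \<in> S p"
    by metis
  define v where "v = (\<lambda>p. if snd p > 0 then u p else goursat (A p) (B p) p)"
  have v: "v p = goursat A' B' p" if g: "good S' A' B'" and p: "cpx p \<in> S'" for S' A' B' p
  proof (cases "snd p > 0")
    case True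
    then have "cpx p \<in> upper_part S'" using p by (simp add: upper_part_def)
    then have "u p = goursat A' B' p" using g unfolding good_def by blast
    then show ?thesis using True by (simp add: v_def)
  next
    case False
    have "p \<in> U" using g p by (auto simp: good_def)
    then have q: "good (S p) (A p) (B p)" "cpx p \<in> S p" using SAB False by auto
    have "goursat (A p) (B p) p = goursat A' B' p"
    proof (rule goursat_uniqueness)
      show "cpx p \<in> S p \<inter> S'" using p q by blast
      show "goursat (A p) (B p) r = goursat A' B' r" if "cpx r \<in> upper_part (S p \<inter> S')" for r
        using g q(1) that unfolding good_def by (metis IntD1 IntD2 IntI upper_part_def)
    qed (use g q in \<open>auto simp: good_def\<close>)
    then show ?thesis using False by (simp add: v_def)
  qed
  have bih: "biharmonic_on U v"
  proof (rule biharmonic_on_locally)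
    fix p assume p: "p \<in> U"
    show "\<exists>T. open T \<and> p \<in> T \<and> biharmonic_on T v"
    proof (cases "snd p > 0")
      case True
      have "open {p::real \<times> real. snd p > 0}" by (intro open_Collect_less continuous_intros)
      then have oU1: "open U1" using U by (simp add: U1 Collect_conj_eq open_Int)
      have "biharmonic_on U1 v"
        by (rule biharmonic_on_cong[OF oU1 _ u]) (simp add: v_def U1)
      then show ?thesis using oU1 True p by (auto simp: U1)
    next
      case False
      then have g: "good (S p) (A p) (B p)" "cpx p \<in> S p" using SAB p by auto
      then have o: "open (S p)" by (auto simp: good_def mirror_domain_def)
      have "biharmonic_on (cpx -` S p) (goursat (A p) (B p))"
        using g o by (intro biharmonic_on_goursat) (auto simp: good_def)
      then have "biharmonic_on (cpx -` S p) v"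
        by (rule biharmonic_on_cong[OF open_vimage_cpx[OF o], rotated]) (simp add: v[OF g(1)])
      then show ?thesis using open_vimage_cpx[OF o] g(2) by auto
    qed
  qed
  have form: "u (x, y) = T v x y" if xy: "(x, y) \<in> U1" "(x, - y) \<in> U" for x y
  proof -
    have y: "y > 0" using xy U1 by simp
    obtain S' A' B' where g: "good S' A' B'" "cpx (x, - y) \<in> S'"
      using ex[OF xy(2)] y by auto
    then have m: "mirror_domain S'" by (simp add: good_def)
    have z: "cpx (x, y) \<in> S'" using mirror_domain.mem_cnj_cpx[OF m g(2)] by simp
    have "u (x, y) = goursat A' B' (x, y)"
      using v[OF g(1) z] y by (simp add: v_def)
    also have "\<dots> = T (goursat A' B') x y" using g(1) z by (simp add: good_def)
    also have "\<dots> = T v x y" by (rule cong[OF m z]) (simp add: v[OF g(1)])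
    finally show ?thesis .
  qed
  show ?thesis
    unfolding biharmonic_continuation_def using bih form by (intro exI[of _ v]) (auto simp: v_def U1)
qed

theorem theorem3p1:
  fixes U U1 U2 \<Gamma> :: "(real \<times> real) set" and u :: "real \<times> real \<Rightarrow> real"
  assumes "open U" and "connected U"
    and "\<Gamma> = {p \<in> U. snd p = 0}"
    and "components (U - \<Gamma>) = {U1, U2}"
    and "U1 \<subseteq> {p. snd p > 0}" and "U2 \<subseteq> {p. snd p < 0}"
    and "reflection_small U U1 U2"
    and "biharmonic_on U1 u"
  shows
    "(vanishes_on U1 \<Gamma> u \<and> vanishes_on U1 \<Gamma> (dy u) \<longrightarrow>
       (\<exists>v. biharmonic_continuation U1 U u v \<and>
         (\<forall>x0 y0. (x0, y0) \<in> U1 \<and> (x0, - y0) \<in> U2 \<longrightarrow>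
           u (x0, y0) = - v (x0, - y0) - 2 * y0 * dy v (x0, - y0)
                        - y0\<^sup>2 * laplacian v (x0, - y0)))) \<and>
     (vanishes_on U1 \<Gamma> u \<and> vanishes_on U1 \<Gamma> (laplacian u) \<longrightarrow>
       (\<exists>v. biharmonic_continuation U1 U u v \<and>
         (\<forall>x0 y0. (x0, y0) \<in> U1 \<and> (x0, - y0) \<in> U2 \<longrightarrow>
           u (x0, y0) = - v (x0, - y0)))) \<and>
     (vanishes_on U1 \<Gamma> u \<and> vanishes_on U1 \<Gamma> (dy (laplacian u)) \<longrightarrow>
       (\<exists>v. biharmonic_continuation U1 U u v \<and>
         (\<forall>x0 y0. (x0, y0) \<in> U1 \<and> (x0, - y0) \<in> U2 \<longrightarrow>
           u (x0, y0) = - v (x0, - y0)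
                        - y0 * (LBINT y=ereal 0..ereal (- y0). laplacian v (x0, y))))) \<and>
     (vanishes_on U1 \<Gamma> (dy u) \<and> vanishes_on U1 \<Gamma> (laplacian u) \<longrightarrow>
       (\<exists>v. biharmonic_continuation U1 U u v \<and>
         (\<forall>x0 y0. (x0, y0) \<in> U1 \<and> (x0, - y0) \<in> U2 \<longrightarrow>
           u (x0, y0) = v (x0, - y0)
                        - (LBINT y=ereal 0..ereal (- y0). y * laplacian v (x0, y))))) \<and>
     (vanishes_on U1 \<Gamma> (dy u) \<and> vanishes_on U1 \<Gamma> (dy (laplacian u)) \<longrightarrow>
       (\<exists>v. biharmonic_continuation U1 U u v \<and>
         (\<forall>x0 y0. (x0, y0) \<in> U1 \<and> (x0, - y0) \<in> U2 \<longrightarrow>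
           u (x0, y0) = v (x0, - y0))))"
proof -
  have un: "U1 \<union> U2 = U - \<Gamma>"
    using Union_components[of "U - \<Gamma>"] assms(4) by simp
  have U1: "U1 = {p \<in> U. snd p > 0}" and U2: "U2 = {p \<in> U. snd p < 0}"
    using un assms(3,5,6) by fastforce+
  \<comment> \<open>Smallness of \<open>U\<close> gives the lower half of the segment, and mirror images give the upper half.\<close>
  have small: "(x, t) \<in> U" if xy: "(x, y) \<in> U" "y \<le> 0" "\<bar>t\<bar> \<le> \<bar>y\<bar>" for x y t
  proof (cases "y = 0")
    case True
    then show ?thesis using xy by simp
  next
    case False
    then have "(x, y) \<in> U2" using xy by (simp add: U2)
    then have seg: "closed_segment (x, 0) (x, y) \<subseteq> U"
      using assms(7) by (simp add: reflection_small_def)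
    have "(x, - \<bar>t\<bar>) \<in> closed_segment (x, 0) (x, y)"
    proof -
      have "0 \<le> \<bar>t\<bar> / - y" "\<bar>t\<bar> / - y \<le> 1" using xy False by (auto simp: field_simps)
      moreover have "(x, - \<bar>t\<bar>) = (1 - \<bar>t\<bar> / - y) *\<^sub>R (x, 0) + (\<bar>t\<bar> / - y) *\<^sub>R (x, y)"
        using False by (simp add: algebra_simps)
      ultimately show ?thesis unfolding in_segment by blast
    qed
    then have low: "(x, - \<bar>t\<bar>) \<in> U" using seg by blast
    show ?thesis
    proof (cases "t > 0")
      case True
      then have "(x, - t) \<in> U2" using low by (simp add: U2)
      then have "(x, - (- t)) \<in> U1" using assms(7) unfolding reflection_small_def by blast
      then show ?thesis by (simp add: U1)
    next
      case False
      then show ?thesis using low by simp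
    qed
  qed
  have axis: "mirror_domain.vanishes_on_axis S (\<lambda>z. f (Re z, Im z))"
    if S: "mirror_domain S" "cpx -` S \<subseteq> U" and f: "vanishes_on U1 \<Gamma> f" for S f
    unfolding mirror_domain.vanishes_on_axis_def[OF S(1)]
  proof (intro ballI impI)
    fix p assume p: "p \<in> S" "Im p = 0"
    have pU: "(Re z, Im z) \<in> U" if "z \<in> S" for z using S(2) that by auto
    have "(f \<longlongrightarrow> 0) (at (Re p, Im p) within U1)"
      using f pU[OF p(1)] p(2) by (simp add: vanishes_on_def assms(3))
    moreover have "filterlim (\<lambda>z. (Re z, Im z)) (at (Re p, Im p) within U1) (at p within upper_part S)"
      unfolding filterlim_at
    proof
      show "eventually (\<lambda>z. (Re z, Im z) \<in> U1 \<and> (Re z, Im z) \<noteq> (Re p, Im p)) (at p within upper_part S)"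
        unfolding eventually_at_filter
        by (intro always_eventually allI impI) (use pU p in \<open>auto simp: U1 upper_part_def\<close>)
      show "((\<lambda>z. (Re z, Im z)) \<longlongrightarrow> (Re p, Im p)) (at p within upper_part S)"
        by (intro tendsto_intros)
    qed
    ultimately show "((\<lambda>z. f (Re z, Im z)) \<longlongrightarrow> 0) (at p within upper_part S)"
      by (rule filterlim_compose)
  qed
  have bih: "biharmonic_on (cpx -` upper_part S) u" if "cpx -` S \<subseteq> U" for S
  proof -
    have "cpx -` upper_part S \<subseteq> U1" using that by (auto simp: U1 upper_part_def)
    then show ?thesis using assms(8) Ck_on_subset unfolding biharmonic_on_def by blast
  qed
  have glue: "\<exists>v. biharmonic_continuation U1 U u v \<and>
      (\<forall>x0 y0. (x0, y0) \<in> U1 \<and> (x0, - y0) \<in> U2 \<longrightarrow> u (x0, y0) = T v x0 y0)"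
    if loc: "\<And>S. mirror_domain S \<Longrightarrow> cpx -` S \<subseteq> U \<Longrightarrow> mirror_domain.local_continuation S u T"
      and cong: "\<And>f g x y. f (x, - y) = g (x, - y) \<Longrightarrow> dy f (x, - y) = dy g (x, - y) \<Longrightarrow>
        (\<And>t. \<bar>t\<bar> \<le> \<bar>y\<bar> \<Longrightarrow> laplacian f (x, t) = laplacian g (x, t)) \<Longrightarrow> T f x y = T g x y" for T
  proof -
    have "\<exists>v. biharmonic_continuation U1 U u v \<and>
      (\<forall>x0 y0. (x0, y0) \<in> U1 \<and> (x0, - y0) \<in> U \<longrightarrow> u (x0, y0) = T v x0 y0)"
    proof (rule continuation_from_local[OF assms(1) U1 assms(8) small loc])
      fix S x y and f g :: "real \<times> real \<Rightarrow> real"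
      assume S: "mirror_domain S" and z: "cpx (x, y) \<in> S" and eq: "\<And>p. p \<in> cpx -` S \<Longrightarrow> f p = g p"
      have o: "open (cpx -` S)" using S by (intro open_vimage_cpx) (simp add: mirror_domain_def)
      have z': "(x, - y) \<in> cpx -` S" using mirror_domain.mem_cnj_cpx[OF S z] by simp
      show "T f x y = T g x y"
      proof (rule cong)
        show "f (x, - y) = g (x, - y)" by (rule eq[OF z'])
        show "dy f (x, - y) = dy g (x, - y)" by (rule dy_cong[OF o z' eq])
        fix t assume "\<bar>t\<bar> \<le> \<bar>y\<bar>"
        then have "(x, t) \<in> cpx -` S"
          using mirror_domain.vertical_in[OF S z, of t] by (simp add: cpx_def)
        then show "laplacian f (x, t) = laplacian g (x, t)" by (rule laplacian_cong[OF o _ eq])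
      qed
    qed
    then show ?thesis using U2 by blast
  qed
  have LBINT_cong: "(LBINT t=ereal 0..ereal (- y). f t) = (LBINT t=ereal 0..ereal (- y). g t)"
    if "\<And>t. \<bar>t\<bar> \<le> \<bar>y\<bar> \<Longrightarrow> f t = g t" for f g :: "real \<Rightarrow> real" and y
    by (rule interval_integral_cong)
      (auto simp: einterval_iff min_def max_def intro!: that split: if_splits)
  show ?thesis
  proof (intro conjI impI; elim conjE)
    assume "vanishes_on U1 \<Gamma> u" "vanishes_on U1 \<Gamma> (dy u)"
    then show "\<exists>v. biharmonic_continuation U1 U u v \<and> (\<forall>x0 y0. (x0, y0) \<in> U1 \<and> (x0, - y0) \<in> U2 \<longrightarrow>
        u (x0, y0) = - v (x0, - y0) - 2 * y0 * dy v (x0, - y0) - y0\<^sup>2 * laplacian v (x0, - y0))"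
      by (intro glue[of "\<lambda>v x y. - v (x, - y) - 2 * y * dy v (x, - y) - y\<^sup>2 * laplacian v (x, - y)"]
          mirror_domain.local_continuation_value_slope axis bih) simp_all
  next
    assume "vanishes_on U1 \<Gamma> u" "vanishes_on U1 \<Gamma> (laplacian u)"
    then show "\<exists>v. biharmonic_continuation U1 U u v \<and> (\<forall>x0 y0. (x0, y0) \<in> U1 \<and> (x0, - y0) \<in> U2 \<longrightarrow>
        u (x0, y0) = - v (x0, - y0))"
      by (intro glue[of "\<lambda>v x y. - v (x, - y)"]
          mirror_domain.local_continuation_value_laplacian axis bih) simp_all
  next
    assume "vanishes_on U1 \<Gamma> u" "vanishes_on U1 \<Gamma> (dy (laplacian u))"
    then show "\<exists>v. biharmonic_continuation U1 U u v \<and> (\<forall>x0 y0. (x0, y0) \<in> U1 \<and> (x0, - y0) \<in> U2 \<longrightarrow>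
        u (x0, y0) = - v (x0, - y0) - y0 * (LBINT t=ereal 0..ereal (- y0). laplacian v (x0, t)))"
      by (intro glue[of "\<lambda>v x y. - v (x, - y) - y * (LBINT t=ereal 0..ereal (- y). laplacian v (x, t))"]
          mirror_domain.local_continuation_value_flux axis bih) (simp_all cong: LBINT_cong)
  next
    assume "vanishes_on U1 \<Gamma> (dy u)" "vanishes_on U1 \<Gamma> (laplacian u)"
    then show "\<exists>v. biharmonic_continuation U1 U u v \<and> (\<forall>x0 y0. (x0, y0) \<in> U1 \<and> (x0, - y0) \<in> U2 \<longrightarrow>
        u (x0, y0) = v (x0, - y0) - (LBINT t=ereal 0..ereal (- y0). t * laplacian v (x0, t)))"
      by (intro glue[of "\<lambda>v x y. v (x, - y) - (LBINT t=ereal 0..ereal (- y). t * laplacian v (x, t))"]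
          mirror_domain.local_continuation_slope_laplacian axis bih) (simp_all cong: LBINT_cong)
  next
    assume "vanishes_on U1 \<Gamma> (dy u)" "vanishes_on U1 \<Gamma> (dy (laplacian u))"
    then show "\<exists>v. biharmonic_continuation U1 U u v \<and> (\<forall>x0 y0. (x0, y0) \<in> U1 \<and> (x0, - y0) \<in> U2 \<longrightarrow>
        u (x0, y0) = v (x0, - y0))"
      by (intro glue[of "\<lambda>v x y. v (x, - y)"]
          mirror_domain.local_continuation_slope_flux axis bih) simp_all
  qed
qed

end
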